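(* Let $F$ be a field of characteristic $\neq 2$. Let $f:\mathbb{N}\to\mathbb{N}$ be an increasing, submultiplicative function such that $f(n)\sim n f(n)$. Then there exists a finitely generated simple Lie algebra $\mathfrak{g}$ over $F$ whose growth function satisfies $\gamma_{\mathfrak{g}}(n)\sim f(n)$.
   Context: $\mathbb{N}=\{1,2,3,\dots\}$. A function $f:\mathbb{N}\to\mathbb{N}$ is increasing if $f(n)<f(n+1)$ for all $n$, and submultiplicative if $f(n+m)\le f(n)f(m)$ for all $n,m$. For functions $f,g:\mathbb{N}\to[0,\infty)$ write $f\preceq g$ if there exist constants $C,D>0$ (where $D$ may be taken to be a positive integer) such that $f(n)\le C g(Dn)$ for all $n\in\mathbb{N}$, and $f\sim g$ if $f\preceq g$ and $g\preceq f$. The condition $f(n)\sim nf(n)$ means that the functions $n\mapsto f(n)$ and $n\mapsto n f(n)$ are equivalent in this sense. For a finitely generated Lie algebra $\mathfrak{g}$ over $F$ and a finite-dimensional subspace $V\subseteq\mathfrak{g}$ generating $\mathfrak{g}$ as a Lie algebra, the growth function is $\gamma_{\mathfrak{g},V}(n)=\dim_F\big(\sum_{i=1}^{n}V^{[i]}\big)$, where $V^{[i]}$ is the span of all length-$i$ Lie products of elements of $V$. Up to $\sim$ it does not depend on the choice of $V$, and is denoted $\gamma_{\mathfrak{g}}(n)$. *)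

theory Defs
  imports Complex_Main "HOL-Computational_Algebra.Polynomial"
begin

text \<open>
  A function on \<open>{1, 2, 3, \<dots>}\<close> is represented by a function on \<^typ>\<open>nat\<close> whose value at \<open>0\<close>
  is irrelevant. For \<open>n \<ge> 1\<close> and \<open>D \<ge> 1\<close> the argument \<open>D * n\<close> is again at least \<open>1\<close>.
\<close>

definition growth_le :: "(nat \<Rightarrow> real) \<Rightarrow> (nat \<Rightarrow> real) \<Rightarrow> bool"  (infix \<open>\<preceq>\<^sub>g\<close> 50)
  where "f \<preceq>\<^sub>g g \<longleftrightarrow> (\<exists>C>0. \<exists>D>0. \<forall>n\<ge>1. f n \<le> C * g (D * n))"

definition growth_equiv :: "(nat \<Rightarrow> real) \<Rightarrow> (nat \<Rightarrow> real) \<Rightarrow> bool"  (infix \<open>\<sim>\<^sub>g\<close> 50)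
  where "f \<sim>\<^sub>g g \<longleftrightarrow> f \<preceq>\<^sub>g g \<and> g \<preceq>\<^sub>g f"

locale lie_algebra = vector_space scale
  for scale :: "'a::field \<Rightarrow> 'b::ab_group_add \<Rightarrow> 'b" +
  fixes bracket :: "'b \<Rightarrow> 'b \<Rightarrow> 'b"
  assumes bracket_add_left: "bracket (x + y) z = bracket x z + bracket y z"
    and bracket_add_right: "bracket x (y + z) = bracket x y + bracket x z"
    and bracket_scale_left: "bracket (scale c x) y = scale c (bracket x y)"
    and bracket_scale_right: "bracket x (scale c y) = scale c (bracket x y)"
    and bracket_self: "bracket x x = 0"
    and jacobi: "bracket x (bracket y z) + bracket y (bracket z x) + bracket z (bracket x y) = 0"
begin

definition subalgebra :: "'b set \<Rightarrow> bool"
  where "subalgebra S \<longleftrightarrow> subspace S \<and> (\<forall>x\<in>S. \<forall>y\<in>S. bracket x y \<in> S)"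

definition ideal :: "'b set \<Rightarrow> bool"
  where "ideal I \<longleftrightarrow> subspace I \<and> (\<forall>x. \<forall>y\<in>I. bracket x y \<in> I)"

definition simple :: bool
  where "simple \<longleftrightarrow> (\<exists>x y. bracket x y \<noteq> 0) \<and> (\<forall>I. ideal I \<longrightarrow> I = {0} \<or> I = UNIV)"

definition generates :: "'b set \<Rightarrow> bool"
  where "generates S \<longleftrightarrow> subalgebra hull S = UNIV"

definition finitely_generated :: bool
  where "finitely_generated \<longleftrightarrow> (\<exists>S. finite S \<and> generates S)"

definition fin_dim_subspace :: "'b set \<Rightarrow> bool"
  where "fin_dim_subspace V \<longleftrightarrow> subspace V \<and> (\<exists>B. finite B \<and> V = span B)"

text \<open>\<open>lie_product V i x\<close>: \<open>x\<close> is a Lie product of \<open>i\<close> elements of \<open>V\<close>, with any arrangement of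
  brackets.\<close>

inductive lie_product :: "'b set \<Rightarrow> nat \<Rightarrow> 'b \<Rightarrow> bool" for V
  where
    base: "x \<in> V \<Longrightarrow> lie_product V 1 x"
  | step: "lie_product V i x \<Longrightarrow> lie_product V j y \<Longrightarrow> lie_product V (i + j) (bracket x y)"

definition lie_power :: "'b set \<Rightarrow> nat \<Rightarrow> 'b set"
  where "lie_power V i = span {x. lie_product V i x}"

text \<open>The sum of a family of subspaces is the span of its union.\<close>

definition growth :: "'b set \<Rightarrow> nat \<Rightarrow> nat"
  where "growth V n = dim (span (\<Union>i\<in>{1..n}. lie_power V i))"

end

text \<open>
  An existential statement cannot range over types, so a Lie algebra over \<open>F\<close> whose existence is
  asserted needs a named underlying vector space. An infinite-dimensional finitely generated Lie
  algebra has countable dimension, hence is isomorphic to one whose underlying vector space is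
  \<open>F[x]\<close> with scalar multiplication \<^const>\<open>smult\<close>; the multiplication of polynomials plays no role.
\<close>

end

theory Submission
  imports Defs "HOL-Library.Countable_Set" "HOL-Library.Sublist"
begin

text \<open>
Let \<open>x\<close> be a bi-infinite word over a finite alphabet, and let \<open>R\<close> be the algebra of operators on
functions \<open>int \<Rightarrow> 'a\<close> spanned by the weighted shifts \<open>u \<mapsto> (\<lambda>i. g i * u (i + k))\<close> whose weight \<open>g i\<close>
depends only on a bounded window of \<open>x\<close> around \<open>i\<close>. Write \<open>p\<close> for the factor complexity of \<open>x\<close>.
Operators with windows of radius \<open>n\<close> and shifts by at most \<open>n\<close> form a space of dimension at most
\<open>(2 * n + 1) * p (2 * n + 1)\<close> (\<open>band_finite_span\<close>), while the products of \<open>2 * n\<close> generators that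
read the factors of length \<open>n\<close> are independent, and there are \<open>p n\<close> of them
(\<open>independent_factor_shifts\<close>). So the growth of \<open>R\<close> lies between \<open>p n\<close> and \<open>n * p n\<close> up to
rescaling. As \<open>f\<close> is equivalent to \<open>n * f n\<close>, it absorbs all powers of \<open>n\<close> (\<open>absorb_powers\<close>), and
it suffices to find a word with \<open>p\<close> between \<open>f\<close> and a polynomial multiple of \<open>f\<close>.

The Lie algebra is \<open>[R, R]\<close>, the span of the commutators. The letters of \<open>x\<close> reveal positions
modulo 4, so \<open>R\<close> contains four by four matrix units. A product \<open>ab\<close> of elements from the positions
\<open>(i, j)\<close> and \<open>(j, k)\<close> with \<open>i \<noteq> k\<close> is the commutator \<open>[a, b]\<close>. This turns associative words into
Lie words of the same length (\<open>corner_prod_in_lie_power\<close>), so \<open>[R, R]\<close> is finitely generated and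
inherits the growth of \<open>R\<close>. It also shows that \<open>[R, R]\<close> is simple when \<open>R\<close> is simple, \<open>2\<close> is
invertible and \<open>[R, R]\<close> contains no nonzero central element of \<open>R\<close> (\<open>derived_simple\<close>). The algebra
\<open>R\<close> is simple because \<open>x\<close> is aperiodic and uniformly recurrent. A central element is constant
along each diagonal, and zero off the main one by aperiodicity. The diagonal of an element of
\<open>[R, R]\<close> sums to zero between any two places of \<open>x\<close> with sufficiently large equal surroundings. As
\<open>x\<close> contains such places at a distance \<open>2 ^ k\<close>, which is invertible, the constant on the main
diagonal vanishes as well (\<open>derived_centre_trivial\<close>).

The word is a limit of blocks of length \<open>4 * 2 ^ k\<close>. A block of level \<open>k + 1\<close> is the concatenation
of a block of level \<open>k\<close> and one of a selected set of blocks of level \<open>k\<close>. The cardinality of the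
selected set is chosen so that there are about \<open>2 ^ k * f (2 ^ k)\<close> blocks of level \<open>k\<close>;
submultiplicativity of \<open>f\<close> guarantees that there are enough blocks to select from
(\<open>card_blocks_bounds\<close>). In the limit every second block of level \<open>k\<close> is a selected one, hence the
number of adjacent pairs is at most twice the number of blocks of level \<open>k + 1\<close>, and
\<open>p (4 * 2 ^ k)\<close> exceeds this number at most by a factor of order \<open>2 ^ k\<close> (\<open>complexity_upper\<close>). For
uniform recurrence, the selected blocks of level \<open>k\<close> are required to contain a prescribed word
whenever this leaves at least a fraction \<open>2 ^ - k\<close> of all blocks, and every block of every level
is eventually prescribed (\<open>eventually_contained\<close>). The loss of a factor \<open>2 ^ k\<close> is harmless
because of the factor \<open>2 ^ k\<close> in the number of blocks.
\<close>

section \<open>Growth functions of Lie algebras\<close>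

context vector_space begin

text \<open>The dimension of an infinite-dimensional space is \<open>0\<close>, being the cardinality of an infinite
  basis. Monotonicity therefore holds only inside the span of a finite set.\<close>

lemma dim_mono_finite_span:
  assumes "A \<subseteq> span B" "B \<subseteq> span T" "finite T"
  shows "dim A \<le> dim B"
proof -
  obtain C where C: "C \<subseteq> B" "independent C" "B \<subseteq> span C" "card C = dim B"
    by (rule basis_exists)
  have "C \<subseteq> span T" using C(1) assms(2) by (rule subset_trans)
  with C(2) have "finite C" using independent_span_bound[OF assms(3)] by auto
  moreover have "A \<subseteq> span C"
    using assms(1) span_minimal[OF C(3) subspace_span] by (rule subset_trans)
  ultimately show ?thesis using dim_le_card[of A C] C(4) by simp
qed

lemma card_le_dim_of_independent:
  assumes "independent B" "B \<subseteq> span A" "A \<subseteq> span T" "finite T"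
  shows "card B \<le> dim A"
  using dim_mono_finite_span[OF assms(2-4)] assms(1) by (simp add: dim_eq_card_independent)

end

context lie_algebra begin

definition filt :: "'b set \<Rightarrow> nat \<Rightarrow> 'b set"
  where "filt V n = span (\<Union>i\<in>{1..n}. lie_power V i)"

lemma subspace_filt: "subspace (filt V n)"
  by (simp add: filt_def)

lemma filt_mono: "m \<le> n \<Longrightarrow> filt V m \<subseteq> filt V n"
  unfolding filt_def by (intro span_mono UN_mono) auto

lemma lie_power_subset_filt: "1 \<le> i \<Longrightarrow> i \<le> n \<Longrightarrow> lie_power V i \<subseteq> filt V n"
  unfolding filt_def by (rule subset_trans[OF _ span_superset]) auto

lemma bracket_zero_left [simp]: "bracket 0 x = 0"
  using bracket_add_left[of 0 0 x] by simp

lemma bracket_zero_right [simp]: "bracket x 0 = 0"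
  using bracket_add_right[of x 0 0] by simp

lemma bracket_span_span:
  assumes x: "x \<in> span A" and y: "y \<in> span B" and S: "subspace S"
    and ab: "\<And>a b. a \<in> A \<Longrightarrow> b \<in> B \<Longrightarrow> bracket a b \<in> S"
  shows "bracket x y \<in> S"
proof -
  have 1: "bracket a y \<in> S" if "a \<in> A" for a
    using y
  proof (induction rule: span_induct_alt)
    case base
    show ?case using S by (simp add: subspace_0)
  next
    case (step c b y)
    then show ?case using S ab[OF that]
      by (simp add: bracket_add_right bracket_scale_right subspace_add subspace_scale)
  qed
  show ?thesis using x
  proof (induction rule: span_induct_alt)
    case base
    show ?case using S by (simp add: subspace_0)
  next
    case (step c b y)
    then show ?case using S 1
      by (simp add: bracket_add_left bracket_scale_left subspace_add subspace_scale)
  qed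
qed

lemma lie_power_bracket:
  assumes "x \<in> lie_power V i" "y \<in> lie_power V j"
  shows "bracket x y \<in> lie_power V (i + j)"
  using assms unfolding lie_power_def
  by (rule bracket_span_span) (auto intro: span_base lie_product.step)

lemma subset_lie_power_1: "V \<subseteq> lie_power V 1"
  unfolding lie_power_def
  by (rule subset_trans[OF _ span_superset]) (auto intro: lie_product.base[simplified])

lemma filt_bracket:
  assumes "x \<in> filt V m" "y \<in> filt V n"
  shows "bracket x y \<in> filt V (m + n)"
proof (rule bracket_span_span[OF assms[unfolded filt_def] subspace_filt])
  fix a b assume "a \<in> (\<Union>i\<in>{1..m}. lie_power V i)" "b \<in> (\<Union>i\<in>{1..n}. lie_power V i)"
  then obtain i j where "1 \<le> i" "i \<le> m" "a \<in> lie_power V i" "1 \<le> j" "j \<le> n" "b \<in> lie_power V j"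
    by auto
  then show "bracket a b \<in> filt V (m + n)"
    using lie_power_bracket[of a V i b j] lie_power_subset_filt[of "i + j" "m + n" V] by auto
qed

lemma subalgebra_Union_filt: "subalgebra (\<Union>n. filt V n)"
  unfolding subalgebra_def
proof (intro conjI ballI)
  show "subspace (\<Union>n. filt V n)"
  proof (rule subspaceI)
    show "0 \<in> (\<Union>n. filt V n)" using subspace_0[OF subspace_filt] by auto
  next
    fix x y assume "x \<in> (\<Union>n. filt V n)" "y \<in> (\<Union>n. filt V n)"
    then obtain m n where "x \<in> filt V m" "y \<in> filt V n" by auto
    then have "x \<in> filt V (max m n)" "y \<in> filt V (max m n)"
      using filt_mono[of m "max m n" V] filt_mono[of n "max m n" V] by auto
    then have "x + y \<in> filt V (max m n)" by (rule subspace_add[OF subspace_filt])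
    then show "x + y \<in> (\<Union>n. filt V n)" by (rule UN_I[OF UNIV_I])
  next
    fix c x assume "x \<in> (\<Union>n. filt V n)"
    then obtain n where "x \<in> filt V n" by auto
    then have "scale c x \<in> filt V n" by (rule subspace_scale[OF subspace_filt])
    then show "scale c x \<in> (\<Union>n. filt V n)" by (rule UN_I[OF UNIV_I])
  qed
next
  fix x y assume "x \<in> (\<Union>n. filt V n)" "y \<in> (\<Union>n. filt V n)"
  then obtain m n where "x \<in> filt V m" "y \<in> filt V n" by auto
  then have "bracket x y \<in> filt V (m + n)" by (rule filt_bracket)
  then show "bracket x y \<in> (\<Union>n. filt V n)" by (rule UN_I[OF UNIV_I])
qed

lemma generates_exhausts:
  assumes "generates V"
  shows "\<exists>n. x \<in> filt V n"
proof -
  have "V \<subseteq> (\<Union>n. filt V n)"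
    using subset_lie_power_1[of V] lie_power_subset_filt[of 1 1 V] by auto
  then have "subalgebra hull V \<subseteq> (\<Union>n. filt V n)"
    by (rule hull_minimal) (rule subalgebra_Union_filt)
  with assms show ?thesis by (auto simp: generates_def)
qed

lemma fin_dim_subset_filt:
  assumes "fin_dim_subspace V" "generates W"
  shows "\<exists>D>0. V \<subseteq> filt W D"
proof -
  obtain B where B: "finite B" "V = span B" using assms(1) by (auto simp: fin_dim_subspace_def)
  obtain d where d: "\<And>x. x \<in> filt W (d x)" using generates_exhausts[OF assms(2)] by metis
  define D where "D = Suc (Max (insert 0 (d ` B)))"
  have "b \<in> filt W D" if "b \<in> B" for b
  proof -
    have "d b \<le> D" unfolding D_def using that B(1) by (simp add: le_SucI)
    then show ?thesis using d[of b] filt_mono by blast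
  qed
  then have "V \<subseteq> filt W D" unfolding B(2) by (intro span_minimal subspace_filt) auto
  then show ?thesis by (intro exI[of _ D]) (simp add: D_def)
qed

lemma filt_subset_filt:
  assumes "V \<subseteq> filt W D"
  shows "filt V n \<subseteq> filt W (D * n)"
proof -
  have *: "x \<in> filt W (D * i)" if "lie_product V i x" for i x
    using that
  proof (induction rule: lie_product.induct)
    case (base x)
    then show ?case using assms by auto
  next
    case (step i x j y)
    then show ?case using filt_bracket[of x W "D * i" y "D * j"] by (simp add: algebra_simps)
  qed
  have "lie_power V i \<subseteq> filt W (D * n)" if "i \<le> n" for i
    unfolding lie_power_def
  proof (rule span_minimal[OF _ subspace_filt])
    show "{x. lie_product V i x} \<subseteq> filt W (D * n)"
      using * filt_mono[of "D * i" "D * n" W] that by auto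
  qed
  then show ?thesis
    unfolding filt_def[of V] by (intro span_minimal subspace_filt UN_least) simp
qed

text \<open>Two finite-dimensional generating subspaces are contained in finite stages of each other's
  filtration, so their growth functions differ by a rescaling of the argument. Finite
  dimensionality of the stages is asked for one of them only and is inherited by the other.\<close>

lemma growth_equiv_generating:
  assumes V: "fin_dim_subspace V" "generates V" and W: "fin_dim_subspace W" "generates W"
    and fin: "\<And>n. \<exists>T. finite T \<and> filt W n \<subseteq> span T"
  shows "(\<lambda>n. real (growth V n)) \<sim>\<^sub>g (\<lambda>n. real (growth W n))"
proof -
  obtain D where D: "D > 0" "V \<subseteq> filt W D" using fin_dim_subset_filt[OF V(1) W(2)] by auto
  obtain D' where D': "D' > 0" "W \<subseteq> filt V D'" using fin_dim_subset_filt[OF W(1) V(2)] by auto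
  have 1: "growth V n \<le> growth W (D * n)" for n
  proof -
    obtain T where T: "finite T" "filt W (D * n) \<subseteq> span T" using fin by blast
    have "filt V n \<subseteq> span (filt W (D * n))"
      using filt_subset_filt[OF D(2)] span_superset by (rule subset_trans)
    from dim_mono_finite_span[OF this T(2,1)] show ?thesis
      by (simp only: growth_def filt_def)
  qed
  have 2: "growth W n \<le> growth V (D' * n)" for n
  proof -
    obtain T where T: "finite T" "filt W (D * (D' * n)) \<subseteq> span T" using fin by blast
    have V: "filt V (D' * n) \<subseteq> span T"
      using filt_subset_filt[OF D(2)] T(2) by (rule subset_trans)
    have "filt W n \<subseteq> span (filt V (D' * n))"
      using filt_subset_filt[OF D'(2)] span_superset by (rule subset_trans)
    from dim_mono_finite_span[OF this V T(1)] show ?thesis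
      by (simp only: growth_def filt_def)
  qed
  have "real (growth V n) \<le> 1 * real (growth W (D * n))" for n
    using 1 by simp
  moreover have "real (growth W n) \<le> 1 * real (growth V (D' * n))" for n
    using 2 by simp
  ultimately show ?thesis
    unfolding growth_equiv_def growth_le_def using D(1) D'(1) zero_less_one by blast
qed

end

lemma (in lie_algebra) lie_power_subset_subalgebra:
  assumes "subalgebra H" "V \<subseteq> H"
  shows "lie_power V i \<subseteq> H"
proof -
  have "x \<in> H" if "lie_product V i x" for x i
    using that by induction (use assms in \<open>auto simp: subalgebra_def\<close>)
  then show ?thesis
    unfolding lie_power_def using assms(1) by (intro span_minimal) (auto simp: subalgebra_def)
qed

section \<open>Commutators in an algebra with four by four matrix units\<close>

definition commutator :: "'r::ring \<Rightarrow> 'r \<Rightarrow> 'r"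
  where "commutator x y = x * y - y * x"

lemma commutator_mult_left: "commutator (a * b) c = commutator a (b * c) + commutator b (c * a)"
  by (simp add: commutator_def algebra_simps)

lemma commutator_add_left: "commutator (x + y) z = commutator x z + commutator y z"
  by (simp add: commutator_def algebra_simps)

lemma commutator_add_right: "commutator x (y + z) = commutator x y + commutator x z"
  by (simp add: commutator_def algebra_simps)

lemma commutator_zero [simp]: "commutator 0 x = 0" "commutator x 0 = 0"
  by (simp_all add: commutator_def)

lemma commutator_sum_right: "commutator x (\<Sum>i\<in>A. f i) = (\<Sum>i\<in>A. commutator x (f i))"
  by (induction A rule: infinite_finite_induct) (simp_all add: commutator_add_right)

locale assoc_algebra = vector_space scale
  for scale :: "'a::field \<Rightarrow> 'r::ring_1 \<Rightarrow> 'r" +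
  assumes scale_mult_left: "scale c x * y = scale c (x * y)"
    and scale_mult_right: "x * scale c y = scale c (x * y)"
begin

definition subalg :: "'r set \<Rightarrow> bool"
  where "subalg R \<longleftrightarrow> subspace R \<and> 1 \<in> R \<and> (\<forall>x\<in>R. \<forall>y\<in>R. x * y \<in> R)"

definition simple_subalg :: "'r set \<Rightarrow> bool"
  where "simple_subalg R \<longleftrightarrow>
    (\<forall>J\<subseteq>R. subspace J \<longrightarrow> (\<forall>r\<in>R. \<forall>y\<in>J. r * y \<in> J \<and> y * r \<in> J) \<longrightarrow> J = {0} \<or> 1 \<in> J)"

definition derived :: "'r set \<Rightarrow> 'r set"
  where "derived R = span {commutator a b | a b. a \<in> R \<and> b \<in> R}"

lemma subspace_derived: "subspace (derived R)"
  by (simp add: derived_def)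

lemma commutator_in_derived: "a \<in> R \<Longrightarrow> b \<in> R \<Longrightarrow> commutator a b \<in> derived R"
  unfolding derived_def by (rule span_base) auto

lemma commutator_scale_left: "commutator (scale c x) y = scale c (commutator x y)"
  by (simp add: commutator_def scale_mult_left scale_mult_right scale_right_diff_distrib)

lemma commutator_scale_right: "commutator x (scale c y) = scale c (commutator x y)"
  by (simp add: commutator_def scale_mult_left scale_mult_right scale_right_diff_distrib)

lemma mult_span_span:
  assumes x: "x \<in> span A" and y: "y \<in> span B" and S: "subspace S"
    and ab: "\<And>a b. a \<in> A \<Longrightarrow> b \<in> B \<Longrightarrow> a * b \<in> S"
  shows "x * y \<in> S"
proof -
  have 1: "a * y \<in> S" if "a \<in> A" for a
    using y
  proof (induction rule: span_induct_alt)
    case base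
    show ?case using S by (simp add: subspace_0)
  next
    case (step c b y)
    then show ?case using S ab[OF that]
      by (simp add: distrib_left scale_mult_right subspace_add subspace_scale)
  qed
  show ?thesis using x
  proof (induction rule: span_induct_alt)
    case base
    show ?case using S by (simp add: subspace_0)
  next
    case (step c b y)
    then show ?case using S 1
      by (simp add: distrib_right scale_mult_left subspace_add subspace_scale)
  qed
qed

lemma derived_subset:
  assumes "subalg R"
  shows "derived R \<subseteq> R"
  unfolding derived_def using assms
  by (intro span_minimal) (auto simp: subalg_def commutator_def intro: subspace_diff)

end

text \<open>A subalgebra with four by four matrix units. There are four indices, so that any three of
  them leave another one free, and four is a power of two, so that the words constructed below can
  have blocks whose lengths are powers of two.\<close>

locale matrix_algebra = assoc_algebra scale
  for scale :: "'a::field \<Rightarrow> 'r::ring_1 \<Rightarrow> 'r" +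
  fixes R :: "'r set" and E :: "nat \<Rightarrow> nat \<Rightarrow> 'r"
  assumes subalg_R: "subalg R"
    and E_in: "i < 4 \<Longrightarrow> j < 4 \<Longrightarrow> E i j \<in> R"
    and E_mult: "i < 4 \<Longrightarrow> j < 4 \<Longrightarrow> k < 4 \<Longrightarrow> l < 4 \<Longrightarrow>
          E i j * E k l = (if j = k then E i l else 0)"
    and E_sum: "(\<Sum>i<4. E i i) = 1"
begin

lemma subspace_R: "subspace R" and R_mult: "x \<in> R \<Longrightarrow> y \<in> R \<Longrightarrow> x * y \<in> R" and one_R: "1 \<in> R"
  using subalg_R by (auto simp: subalg_def)

lemma ex_index: "\<exists>m<4. m \<noteq> a \<and> m \<noteq> b \<and> m \<noteq> (c::nat)"
proof -
  have "card {a, b, c} < card {..<4::nat}"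
    by (rule le_less_trans[of _ 3]) (auto simp: card_insert_if)
  then have "\<not> {..<4} \<subseteq> {a, b, c}" using card_mono[of "{a, b, c}" "{..<4}"] by auto
  then show ?thesis by auto
qed

text \<open>Membership in the Peirce component \<open>e\<^sub>i R e\<^sub>j\<close> for the idempotents \<open>e\<^sub>i = E i i\<close>.\<close>

definition corner :: "nat \<Rightarrow> nat \<Rightarrow> 'r \<Rightarrow> bool"
  where "corner i j x \<longleftrightarrow> i < 4 \<and> j < 4 \<and> x \<in> R \<and> E i i * x = x \<and> x * E j j = x"

lemma cornerI: "i < 4 \<Longrightarrow> j < 4 \<Longrightarrow> r \<in> R \<Longrightarrow> a < 4 \<Longrightarrow> b < 4 \<Longrightarrow> corner i j (E i a * r * E b j)"
  unfolding corner_def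
  by (auto simp: mult.assoc E_mult intro!: R_mult E_in)
    (simp add: mult.assoc[symmetric] E_mult)

lemma corner_E: "i < 4 \<Longrightarrow> j < 4 \<Longrightarrow> corner i j (E i j)"
  unfolding corner_def by (auto simp: E_mult E_in)

lemma corner_in_R: "corner i j x \<Longrightarrow> x \<in> R"
  by (simp add: corner_def)

lemma corner_mult: "corner i j x \<Longrightarrow> r \<in> R \<Longrightarrow> corner k l y \<Longrightarrow> corner i l (x * r * y)"
  unfolding corner_def
      by (auto intro!: R_mult) (simp_all add: mult.assoc[symmetric], simp add: mult.assoc)

lemma corner_mult2: "corner i j x \<Longrightarrow> corner k l y \<Longrightarrow> corner i l (x * y)"
  using corner_mult[of i j x 1 k l y] by (simp add: one_R)

lemma corner_mult_zero:
  assumes "corner i j x" "corner k l y" "j \<noteq> k"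
  shows "x * y = 0"
proof -
  have "x * y = (x * E j j) * (E k k * y)" using assms by (simp add: corner_def)
  also have "\<dots> = x * (E j j * E k k) * y" by (simp only: mult.assoc)
  also have "\<dots> = 0" using assms by (simp add: E_mult corner_def)
  finally show ?thesis .
qed

text \<open>The product in the opposite order vanishes, because its inner indices differ. All passages
  from associative products to Lie products use this observation.\<close>

lemma commutator_path:
  assumes "corner i j x" "corner k l y" "i \<noteq> l"
  shows "commutator x y = x * y"
  using corner_mult_zero[OF assms(2,1)] assms(3) by (simp add: commutator_def)

lemma corner_decomposition: "r = (\<Sum>i<4. \<Sum>j<4. E i i * r * E j j)"
proof -
  have "r = (\<Sum>i<4. E i i) * r * (\<Sum>j<4. E j j)" by (simp add: E_sum)
  also have "\<dots> = (\<Sum>i<4. E i i * r * (\<Sum>j<4. E j j))" by (simp only: sum_distrib_right)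
  also have "\<dots> = (\<Sum>i<4. \<Sum>j<4. E i i * r * E j j)" by (simp only: sum_distrib_left)
  finally show ?thesis .
qed

lemma corner_in_derived:
  assumes "corner i j x" "i \<noteq> j"
  shows "x \<in> derived R"
proof -
  have "commutator (E i i) x = x"
    using commutator_path[OF corner_E assms(1), of i i] assms by (simp add: corner_def)
  then show ?thesis
    using assms commutator_in_derived[of "E i i" R x] by (simp add: corner_def E_in)
qed

text \<open>The elements all of whose commutators lie in \<open>S\<close> form a subalgebra, by
  \<open>[ab, c] = [a, bc] + [b, ca]\<close>, and the off-diagonal corners generate \<open>R\<close>. Hence to find all
  commutators inside \<open>S\<close> it suffices to look at the off-diagonal corners.\<close>

lemma derived_subset_of_corners:
  assumes S: "subspace S"
    and S1: "\<And>i j x. corner i j x \<Longrightarrow> i \<noteq> j \<Longrightarrow> x \<in> S"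
    and S2: "\<And>i j x k l y. corner i j x \<Longrightarrow> i \<noteq> j \<Longrightarrow> corner k l y \<Longrightarrow> k \<noteq> l \<Longrightarrow> commutator x y \<in> S"
  shows "derived R \<subseteq> S"
proof -
  define N where "N = {a\<in>R. \<forall>b\<in>R. commutator a b \<in> S}"
  have off: "x \<in> N" if x: "corner k l x" and kl: "k \<noteq> l" for k l x
  proof -
    have "commutator x b \<in> S" if b: "b \<in> R" for b
    proof -
      have "commutator x (E i i * b * E j j) \<in> S" if ij: "i < 4" "j < 4" for i j
      proof (cases "i = j")
        case False
        then show ?thesis using S2[OF x kl cornerI] b ij by blast
      next
        case True
        define y where "y = E i i * b * E j j"
        have y: "corner i i y" unfolding y_def using cornerI[of i j b i j] ij b True by simp
        have "x * y \<in> S"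
        proof (cases "l = i")
          case True
          then show ?thesis using S1[OF corner_mult2[OF x y]] kl by simp
        next
          case False
          then show ?thesis using corner_mult_zero[OF x y] S by (simp add: subspace_0)
        qed
        moreover have "y * x \<in> S"
        proof (cases "k = i")
          case True
          then show ?thesis using S1[OF corner_mult2[OF y x]] kl by simp
        next
          case False
          then show ?thesis using corner_mult_zero[OF y x] S by (simp add: subspace_0)
        qed
        ultimately show ?thesis
          unfolding y_def[symmetric] commutator_def by (rule subspace_diff[OF S])
      qed
      then have "commutator x (\<Sum>i<4. \<Sum>j<4. E i i * b * E j j) \<in> S"
        unfolding commutator_sum_right by (intro subspace_sum[OF S]) auto
      then show ?thesis using corner_decomposition[of b] by simp
    qed
    then show ?thesis using corner_in_R[OF x] by (simp add: N_def)
  qed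
  have mult: "a * b \<in> N" if ab: "a \<in> N" "b \<in> N" for a b
  proof -
    have R: "a \<in> R" "b \<in> R" using ab by (simp_all add: N_def)
    have "commutator a (b * c) + commutator b (c * a) \<in> S" if "c \<in> R" for c
      using ab that R by (intro subspace_add[OF S]) (simp_all add: N_def R_mult)
    then show ?thesis using R by (simp add: N_def R_mult commutator_mult_left)
  qed
  have subN: "subspace N"
    unfolding N_def
    by (rule subspaceI)
      (simp_all add: subspace_0[OF S] subspace_0[OF subspace_R] subspace_add[OF S]
        subspace_add[OF subspace_R] subspace_scale[OF S] subspace_scale[OF subspace_R]
        commutator_add_left commutator_scale_left)
  have "r \<in> N" if r: "r \<in> R" for r
  proof -
    have "E i i * r * E j j \<in> N" if ij: "i < 4" "j < 4" for i j
    proof (cases "i = j")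
      case False
      then show ?thesis using off[OF cornerI] ij r by blast
    next
      case True
      obtain m where m: "m < 4" "m \<noteq> i" using ex_index[of i i i] by auto
      have "E i i * r * E j j = (E i i * r * E i m) * E m i"
        using m ij True by (simp add: mult.assoc E_mult)
      moreover have "\<dots> \<in> N"
        using m ij r by (intro mult off[OF cornerI] off[OF corner_E]) auto
      ultimately show ?thesis by simp
    qed
    then have "(\<Sum>i<4. \<Sum>j<4. E i i * r * E j j) \<in> N"
      by (intro subspace_sum[OF subN]) auto
    then show ?thesis using corner_decomposition[of r] by simp
  qed
  then show ?thesis
    unfolding derived_def using S by (intro span_minimal) (auto simp: N_def)
qed

context
  fixes I :: "'r set"
  assumes I: "subspace I" "I \<subseteq> derived R"
    and I_ideal: "\<And>r y. r \<in> derived R \<Longrightarrow> y \<in> I \<Longrightarrow> commutator r y \<in> I"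
begin

text \<open>For an index \<open>k\<close> other than \<open>p\<close> and \<open>q\<close>, left multiplication by \<open>e\<^sub>k a e\<^sub>p\<close> is a commutator
  with an off-diagonal corner. For \<open>k = p\<close> the same step is taken twice, through a third index
  \<open>s\<close>.\<close>

lemma ideal_corner_left:
  assumes y: "y \<in> I" "corner p q y" "p \<noteq> q" and a: "a \<in> R" and k: "k < 4" "k \<noteq> q"
  shows "E k k * a * y \<in> I"
proof -
  have *: "E s s * b * y \<in> I"
    if "y \<in> I" "corner p q y" "s < 4" "s \<noteq> p" "s \<noteq> q" "b \<in> R" for s b y p
  proof -
    have p: "p < 4" "E p p * y = y" using that(2) by (simp_all add: corner_def)
    have c: "corner s p (E s s * b * E p p)" using p that by (intro cornerI)
    have "commutator (E s s * b * E p p) y = E s s * b * E p p * y"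
      using commutator_path[OF c that(2)] that by simp
    also have "\<dots> = E s s * b * y" using p by (simp add: mult.assoc)
    finally show ?thesis
      using I_ideal[OF corner_in_derived[OF c] that(1)] that(4) by simp
  qed
  show ?thesis
  proof (cases "k = p")
    case False
    then show ?thesis using * y a k by auto
  next
    case True
    obtain s where s: "s < 4" "s \<noteq> p" "s \<noteq> q" using ex_index[of p q q] by auto
    have q: "q < 4" "y * E q q = y" "p < 4" "E p p * y = y" using y(2) by (simp_all add: corner_def)
    have "E s s * E s p * y \<in> I" using * y s q by (auto simp: E_in)
    then have 1: "E s p * y \<in> I" using s q by (simp add: E_mult)
    have 2: "corner s q (E s p * y)" using corner_mult2[OF corner_E y(2)] s q by auto
    have "E p p * (a * E p s) * (E s p * y) \<in> I"
      using *[OF 1 2, of p "a * E p s"] s q y(3) a by (auto intro!: R_mult E_in)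
    also have "E p p * (a * E p s) * (E s p * y) = E p p * a * ((E p s * E s p) * y)"
      by (simp only: mult.assoc)
    also have "\<dots> = E k k * a * y" using s q True by (simp add: E_mult)
    finally show ?thesis .
  qed
qed

lemma ideal_corner_right:
  assumes y: "y \<in> I" "corner p q y" "p \<noteq> q" and a: "a \<in> R" and k: "k < 4" "k \<noteq> p"
  shows "y * a * E k k \<in> I"
proof -
  have *: "y * b * E s s \<in> I"
    if "y \<in> I" "corner p q y" "s < 4" "s \<noteq> p" "s \<noteq> q" "b \<in> R" for s b y q
  proof -
    have p: "q < 4" "y * E q q = y" using that(2) by (simp_all add: corner_def)
    have c: "corner q s (E q q * b * E s s)" using p that by (intro cornerI)
    have "commutator y (E q q * b * E s s) = y * (E q q * b * E s s)"
      using commutator_path[OF that(2) c] that by simp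
    also have "\<dots> = (y * E q q) * b * E s s" by (simp only: mult.assoc)
    also have "\<dots> = y * b * E s s" using p by simp
    finally have "commutator (E q q * b * E s s) y = - (y * b * E s s)"
      by (simp add: commutator_def algebra_simps)
    moreover have "commutator (E q q * b * E s s) y \<in> I"
      using I_ideal[OF corner_in_derived[OF c] that(1)] that(5) by simp
    ultimately show ?thesis using subspace_neg[OF I(1)] by fastforce
  qed
  show ?thesis
  proof (cases "k = q")
    case False
    then show ?thesis using * y a k by auto
  next
    case True
    obtain s where s: "s < 4" "s \<noteq> p" "s \<noteq> q" using ex_index[of p q q] by auto
    have q: "q < 4" "y * E q q = y" "p < 4" "E p p * y = y" using y(2) by (simp_all add: corner_def)
    have "y * E q s * E s s \<in> I" using * y s q by (auto simp: E_in)
    then have 1: "y * E q s \<in> I" using s q by (simp add: E_mult mult.assoc)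
    have 2: "corner p s (y * E q s)" using corner_mult2[OF y(2) corner_E] s q by auto
    have "(y * E q s) * (E s q * a) * E q q \<in> I"
      using *[OF 1 2, of q "E s q * a"] s q y(3) a by (auto intro!: R_mult E_in)
    also have "(y * E q s) * (E s q * a) * E q q = y * (E q s * E s q) * a * E q q"
      by (simp only: mult.assoc)
    also have "\<dots> = y * a * E k k" using s q True by (simp add: E_mult)
    finally show ?thesis .
  qed
qed

text \<open>The left and the right multiplication are carried out one after the other, and the element
  in between has to be off-diagonal. It is, for one of the two orders, unless \<open>(k, l) = (q, p)\<close>;
  then the corner is first moved to a row \<open>s\<close> outside \<open>{p, q}\<close>.\<close>

lemma ideal_corner_both:
  assumes y: "y \<in> I" "corner p q y" "p \<noteq> q" and ab: "a \<in> R" "b \<in> R"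
    and kl: "k < 4" "l < 4" "k \<noteq> l"
  shows "E k k * a * y * b * E l l \<in> I"
proof -
  have pq: "p < 4" "q < 4" "E p p * y = y" "y * E q q = y" using y(2) by (simp_all add: corner_def)
  have left_right: "E k k * a * y * b * E l l \<in> I"
    if "y \<in> I" "corner p q y" "p \<noteq> q" "k \<noteq> q" "a \<in> R" "b \<in> R" "k < 4" "l < 4" "k \<noteq> l"
    for k l a b y p q
  proof -
    have c: "corner k q (E k k * a * y)"
      using corner_mult[OF corner_E[of k k] _ that(2)] that by auto
    from ideal_corner_right[OF ideal_corner_left[OF that(1-3)] c] that show ?thesis by auto
  qed
  show ?thesis
  proof (cases "k = q")
    case False
    then show ?thesis using left_right y ab kl by blast
  next
    case True
    obtain s where s: "s < 4" "s \<noteq> p" "s \<noteq> q" "s \<noteq> l" using ex_index[of p q l] by auto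
    show ?thesis
    proof (cases "l = p")
      case False
      have 1: "y * b * E l l \<in> I" using ideal_corner_right y ab kl False by blast
      have 2: "corner p l (y * b * E l l)" using corner_mult[OF y(2) _ corner_E] ab kl by auto
      have "E k k * a * (y * b * E l l) \<in> I"
        using ideal_corner_left[OF 1 2] False ab kl by auto
      then show ?thesis by (simp add: mult.assoc)
    next
      case l: True
      have "E s s * E s p * y \<in> I"
        by (rule ideal_corner_left[OF y]) (use s pq in \<open>auto simp: E_in\<close>)
      then have 1: "E s p * y \<in> I" using s pq by (simp add: E_mult)
      have 2: "corner s q (E s p * y)" using corner_mult2[OF corner_E y(2)] s pq by auto
      have 3: "E s p * y * b * E l l \<in> I"
        using ideal_corner_right[OF 1 2] s ab kl by auto
      have 4: "corner s l (E s p * y * b * E l l)"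
        using corner_mult[OF 2 _ corner_E] ab kl by auto
      have "E k k * (a * E p s) * (E s p * y * b * E l l) \<in> I"
        using ideal_corner_left[OF 3 4] s ab kl pq by (auto intro!: R_mult E_in)
      also have "E k k * (a * E p s) * (E s p * y * b * E l l)
          = E k k * a * ((E p s * E s p) * y) * b * E l l"
        by (simp only: mult.assoc)
      also have "\<dots> = E k k * a * y * b * E l l" using s pq by (simp add: E_mult)
      finally show ?thesis .
    qed
  qed
qed

text \<open>The elements of \<open>R\<close> whose two-sided multiples have all their off-diagonal corners in \<open>I\<close>
  form a two-sided ideal of \<open>R\<close>. It contains \<open>y\<close>, hence \<open>1\<close> by simplicity of \<open>R\<close>.\<close>

lemma derived_subset_ideal:
  assumes "simple_subalg R" and y: "y \<in> I" "corner p q y" "p \<noteq> q" "y \<noteq> 0"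
  shows "derived R \<subseteq> I"
proof -
  define J where "J = {r\<in>R. \<forall>k<4. \<forall>l<4. k \<noteq> l \<longrightarrow> (\<forall>a\<in>R. \<forall>b\<in>R. E k k * a * r * b * E l l \<in> I)}"
  have "subspace J"
    unfolding J_def
    by (rule subspaceI)
      (simp_all add: subspace_0[OF I(1)] subspace_0[OF subspace_R] subspace_add[OF I(1)]
        subspace_add[OF subspace_R] subspace_scale[OF I(1)] subspace_scale[OF subspace_R]
        distrib_left distrib_right scale_mult_left scale_mult_right)
  moreover have "r * z \<in> J \<and> z * r \<in> J" if "r \<in> R" "z \<in> J" for r z
  proof -
    have "E k k * (a * r) * z * b * E l l \<in> I" "E k k * a * z * (r * b) * E l l \<in> I"
      if "k < 4" "l < 4" "k \<noteq> l" "a \<in> R" "b \<in> R" for k l a b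
      using that \<open>r \<in> R\<close> \<open>z \<in> J\<close> R_mult unfolding J_def by blast+
    then show ?thesis using that unfolding J_def by (auto simp: mult.assoc intro: R_mult)
  qed
  moreover have "y \<in> J" using ideal_corner_both[OF y(1-3)] corner_in_R[OF y(2)] by (simp add: J_def)
  moreover have "J \<subseteq> R" by (auto simp: J_def)
  ultimately have "J = {0} \<or> 1 \<in> J" "y \<in> J"
    using assms(1) by (simp_all add: simple_subalg_def)
  then have "1 \<in> J" using y(4) by auto
  then have *: "E k k * a * E l l \<in> I" if "k < 4" "l < 4" "k \<noteq> l" "a \<in> R" for k l a
    using that one_R by (force simp: J_def)
  have off: "x \<in> I" if "corner i j x" "i \<noteq> j" for i j x
    using *[of i j x] that by (simp add: corner_def)
  show ?thesis
    by (rule derived_subset_of_corners[OF I(1)])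
      (auto intro: off I_ideal corner_in_derived)
qed

text \<open>A nonzero ideal contains a nonzero off-diagonal corner. If \<open>x\<close> has a nonzero off-diagonal
  entry in position \<open>(i, j)\<close>, apply the square of the adjoint action of \<open>E j i\<close>; it multiplies
  that entry by \<open>- 2\<close> and moves it to \<open>(j, i)\<close>. If \<open>x\<close> is block diagonal, its commutator with an
  off-diagonal corner is again such a corner, and these commutators all vanish only if \<open>x\<close> is
  central.\<close>

lemma ideal_contains_corner:
  assumes two: "(2::'a) \<noteq> 0"
    and centre: "\<And>z. z \<in> derived R \<Longrightarrow> (\<And>r. r \<in> R \<Longrightarrow> z * r = r * z) \<Longrightarrow> z = 0"
    and x: "x \<in> I" "x \<noteq> 0"
  shows "\<exists>y p q. y \<in> I \<and> corner p q y \<and> p \<noteq> q \<and> y \<noteq> 0"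
proof (cases "\<exists>i<4. \<exists>j<4. i \<noteq> j \<and> E i i * x * E j j \<noteq> 0")
  case True
  then obtain i j where ij: "i < 4" "j < 4" "i \<noteq> j" "E i i * x * E j j \<noteq> 0" by auto
  have xR: "x \<in> R" using x I(2) derived_subset[OF subalg_R] by auto
  define e where "e = E j i"
  have ee: "e * e = 0" "e * (e * z) = 0" for z
    using ij by (simp_all add: e_def E_mult mult.assoc[symmetric])
  have eD: "e \<in> derived R" using corner_in_derived[OF corner_E] ij by (auto simp: e_def)
  have "commutator e (commutator e x) = - (e * x * e + e * x * e)"
    using ee by (simp add: commutator_def algebra_simps)
  also have "\<dots> = scale (- 2) (e * x * e)"
    using scale_left_distrib[of 1 1 "e * x * e"] by simp
  finally have "scale (- 2) (e * x * e) \<in> I"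
    using I_ideal[OF eD I_ideal[OF eD x(1)]] by simp
  then have "scale (inverse (- 2)) (scale (- 2) (e * x * e)) \<in> I"
    by (rule subspace_scale[OF I(1)])
  then have 1: "e * x * e \<in> I" using two by simp
  have "e * x * e \<noteq> 0"
  proof
    assume "e * x * e = 0"
    then have "E i j * (e * x * e) * E i j = 0" by simp
    moreover have "E i j * (e * x * e) * E i j = (E i j * e) * x * (e * E i j)"
      by (simp only: mult.assoc)
    ultimately show False using ij by (simp add: e_def E_mult)
  qed
  with 1 show ?thesis
    using cornerI[of j i x i j] ij xR unfolding e_def by blast
next
  case False
  have xR: "x \<in> R" using x I(2) derived_subset[OF subalg_R] by auto
  have Ex: "E i i * x = E i i * x * E i i" "x * E i i = E i i * x * E i i" if "i < 4" for i
  proof -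
    have z: "E k k * x * E l l = 0" if "k < 4" "l < 4" "k \<noteq> l" for k l
      using False that by auto
    have "E i i * x = E i i * x * (\<Sum>j<4. E j j)" by (simp add: E_sum)
    also have "\<dots> = (\<Sum>j<4. E i i * x * E j j)" by (simp only: sum_distrib_left)
    also have "\<dots> = (\<Sum>j<4. if i = j then E i i * x * E i i else 0)"
      using z that by (intro sum.cong) auto
    also have "\<dots> = E i i * x * E i i" using that by simp
    finally show "E i i * x = E i i * x * E i i" .
    have "x * E i i = (\<Sum>j<4. E j j) * x * E i i" by (simp add: E_sum)
    also have "\<dots> = (\<Sum>j<4. E j j * x * E i i)" by (simp only: sum_distrib_right)
    also have "\<dots> = (\<Sum>j<4. if i = j then E i i * x * E i i else 0)"
      using z that by (intro sum.cong) auto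
    also have "\<dots> = E i i * x * E i i" using that by simp
    finally show "x * E i i = E i i * x * E i i" .
  qed
  have comm: "E i i * x = x * E i i" if "i < 4" for i using Ex[OF that] by simp
  have "\<exists>i j r. corner i j r \<and> i \<noteq> j \<and> commutator r x \<noteq> 0"
  proof (rule ccontr)
    assume "\<not> ?thesis"
    then have off: "r * x = x * r" if "corner i j r" "i \<noteq> j" for i j r
      using that by (auto simp: commutator_def)
    have "x * r = r * x" if r: "r \<in> R" for r
    proof -
      have "E i i * r * E j j * x = x * (E i i * r * E j j)" if ij: "i < 4" "j < 4" for i j
      proof (cases "i = j")
        case False
        then show ?thesis using off[OF cornerI] r ij by blast
      next
        case True
        obtain m where m: "m < 4" "m \<noteq> i" using ex_index[of i i i] by auto
        have c: "corner i m (E i i * r * E i m)" "corner m i (E m i)"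
          using cornerI[of i m r i i] corner_E m ij r by auto
        have e: "E i i * r * E j j = (E i i * r * E i m) * E m i"
          using m ij True by (simp add: mult.assoc E_mult)
        have "(E i i * r * E i m) * E m i * x = (E i i * r * E i m) * (x * E m i)"
          using off[OF c(2)] m by (simp add: mult.assoc)
        also have "\<dots> = x * ((E i i * r * E i m) * E m i)"
          using off[OF c(1)] m by (metis mult.assoc)
        finally show ?thesis using e by simp
      qed
      then have "(\<Sum>i<4. \<Sum>j<4. E i i * r * E j j) * x = x * (\<Sum>i<4. \<Sum>j<4. E i i * r * E j j)"
        by (simp add: sum_distrib_left sum_distrib_right)
      then show ?thesis using corner_decomposition[of r] by simp
    qed
    then show False using centre x I(2) by blast
  qed
  then obtain i j r where r: "corner i j r" "i \<noteq> j" "commutator r x \<noteq> 0" by auto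
  have ij: "i < 4" "j < 4" "r \<in> R" "E i i * r = r" "r * E j j = r" using r
      by (auto simp: corner_def)
  have "corner i j (commutator r x)"
    unfolding corner_def
  proof (intro conjI)
    show "commutator r x \<in> R"
      unfolding commutator_def using ij xR by (intro subspace_diff[OF subspace_R] R_mult)
    have "E i i * (x * r) = x * r" using comm[OF ij(1)] ij(4) by (metis mult.assoc)
    then show "E i i * commutator r x = commutator r x"
      using ij by (simp add: commutator_def right_diff_distrib mult.assoc[symmetric])
    have "r * x * E j j = r * x" using comm[OF ij(2)] ij(5) by (metis mult.assoc)
    then show "commutator r x * E j j = commutator r x"
      using ij by (simp add: commutator_def left_diff_distrib mult.assoc)
  qed (use ij in auto)
  moreover have "commutator r x \<in> I"
    using I_ideal[OF corner_in_derived[OF r(1,2)] x(1)] .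
  ultimately show ?thesis using r by blast
qed

end

theorem derived_simple:
  assumes "simple_subalg R" and two: "(2::'a) \<noteq> 0"
    and centre: "\<And>z. z \<in> derived R \<Longrightarrow> (\<And>r. r \<in> R \<Longrightarrow> z * r = r * z) \<Longrightarrow> z = 0"
    and I: "subspace I" "I \<subseteq> derived R"
    and I_ideal: "\<And>r y. r \<in> derived R \<Longrightarrow> y \<in> I \<Longrightarrow> commutator r y \<in> I"
  shows "I = {0} \<or> I = derived R"
proof (cases "I = {0}")
  case False
  then obtain x where x: "x \<in> I" "x \<noteq> 0" using subspace_0[OF I(1)] by auto
  obtain y p q where "y \<in> I" "corner p q y" "p \<noteq> q" "y \<noteq> 0"
    using ideal_contains_corner[OF I I_ideal two centre x] by blast
  from derived_subset_ideal[OF I I_ideal assms(1) this] show ?thesis using I(2) by auto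
qed auto

end

section \<open>Weighted shifts on functions on the integers\<close>

text \<open>Row-finite matrices indexed by the integers act as linear operators on functions. Taking all
  such operators as the ambient ring makes associativity of the product evident.\<close>

typedef (overloaded) ('a::field) endo =
  "{T :: (int \<Rightarrow> 'a) \<Rightarrow> (int \<Rightarrow> 'a).
     (\<forall>u v. T (\<lambda>i. u i + v i) = (\<lambda>i. T u i + T v i)) \<and>
     (\<forall>c u. T (\<lambda>i. c * u i) = (\<lambda>i. c * T u i))}"
  morphisms endo_apply Endo
  by (rule exI[of _ "\<lambda>u. u"]) simp

setup_lifting type_definition_endo

instantiation endo :: (field) ring_1
begin

lift_definition zero_endo :: "'a endo" is "\<lambda>u i. 0" by simp

lift_definition one_endo :: "'a endo" is "\<lambda>u. u" by simp

lift_definition plus_endo :: "'a endo \<Rightarrow> 'a endo \<Rightarrow> 'a endo" is "\<lambda>S T u i. S u i + T u i"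
  by (simp add: algebra_simps)

lift_definition minus_endo :: "'a endo \<Rightarrow> 'a endo \<Rightarrow> 'a endo" is "\<lambda>S T u i. S u i - T u i"
  by (simp add: algebra_simps)

lift_definition uminus_endo :: "'a endo \<Rightarrow> 'a endo" is "\<lambda>T u i. - T u i"
  by (simp add: algebra_simps)

lift_definition times_endo :: "'a endo \<Rightarrow> 'a endo \<Rightarrow> 'a endo" is "\<lambda>S T u. S (T u)"
  by simp

instance
proof
  show "(0 :: 'a endo) \<noteq> 1"
  proof (transfer, rule notI)
    assume "(\<lambda>u i. 0) = (\<lambda>u :: int \<Rightarrow> 'a. u)"
    then have "(\<lambda>i::int. 0::'a) = (\<lambda>i. 1)" by (rule fun_cong)
    then show False by (simp add: fun_eq_iff)
  qed
qed (transfer; simp add: algebra_simps)+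

end

lift_definition scale_endo :: "'a::field \<Rightarrow> 'a endo \<Rightarrow> 'a endo" is "\<lambda>c T u i. c * T u i"
  by (simp add: algebra_simps)

interpretation endo: assoc_algebra scale_endo
  by unfold_locales (transfer; simp add: algebra_simps)+

lift_definition weighted_shift :: "(int \<Rightarrow> 'a::field) \<Rightarrow> int \<Rightarrow> 'a endo"
  is "\<lambda>g k u i. g i * u (i + k)"
  by (simp add: algebra_simps)

text \<open>The matrix entry in row \<open>i\<close> on diagonal \<open>l\<close>, that is, in column \<open>i + l\<close>.\<close>

definition entry :: "'a::field endo \<Rightarrow> int \<Rightarrow> int \<Rightarrow> 'a"
  where "entry T i l = endo_apply T (\<lambda>j. if j = i + l then 1 else 0) i"

lemma weighted_shift_mult:
  "weighted_shift g k * weighted_shift h l = weighted_shift (\<lambda>i. g i * h (i + k)) (k + l)"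
  by transfer (simp add: algebra_simps)

lemma weighted_shift_one: "weighted_shift (\<lambda>_. 1) 0 = 1"
  by transfer simp

lemma weighted_shift_add:
  "weighted_shift (\<lambda>i. g i + h i) k = weighted_shift g k + weighted_shift h k"
  by transfer (simp add: algebra_simps)

lemma weighted_shift_scale: "weighted_shift (\<lambda>i. c * g i) k = scale_endo c (weighted_shift g k)"
  by transfer (simp add: algebra_simps)

lemma weighted_shift_zero: "weighted_shift (\<lambda>_. 0) k = 0"
  by transfer simp

lemma weighted_shift_sum:
  "weighted_shift (\<lambda>i. \<Sum>u\<in>A. g u i) k = (\<Sum>u\<in>A. weighted_shift (g u) k)"
  by (induction A rule: infinite_finite_induct) (simp_all add: weighted_shift_zero
      weighted_shift_add)

lemma entry_add [simp]: "entry (S + T) i l = entry S i l + entry T i l"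
  and entry_diff [simp]: "entry (S - T) i l = entry S i l - entry T i l"
  and entry_zero [simp]: "entry 0 i l = 0"
  and entry_scale [simp]: "entry (scale_endo c T) i l = c * entry T i l"
  unfolding entry_def by (transfer; simp)+

lemma entry_weighted_shift: "entry (weighted_shift g k) i l = (if l = k then g i else 0)"
  unfolding entry_def by transfer auto

lemma entry_shift_left: "entry (weighted_shift h k * z) i l = h i * entry z (i + k) (l - k)"
  unfolding entry_def by transfer (simp add: algebra_simps)

lemma entry_shift_right: "entry (z * weighted_shift h k) i l = entry z i (l - k) * h (i + l - k)"
  unfolding entry_def
proof (transfer fixing: h k i l)
  fix z :: "(int \<Rightarrow> 'a) \<Rightarrow> int \<Rightarrow> 'a"
  assume z: "(\<forall>u v. z (\<lambda>i. u i + v i) = (\<lambda>i. z u i + z v i)) \<and>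
     (\<forall>c u. z (\<lambda>i. c * u i) = (\<lambda>i. c * z u i))"
  have "(\<lambda>j. h j * (if j + k = i + l then 1 else 0))
      = (\<lambda>j. h (i + l - k) * (if j = i + (l - k) then 1 else 0))"
  proof (rule ext)
    fix j show "h j * (if j + k = i + l then 1 else 0)
        = h (i + l - k) * (if j = i + (l - k) then 1 else 0)"
      by (cases "j = i + l - k") auto
  qed
  then show "z (\<lambda>j. h j * (if j + k = i + l then 1 else 0)) i
      = z (\<lambda>j. if j = i + (l - k) then 1 else 0) i * h (i + l - k)"
    using z by (simp add: mult.commute)
qed

section \<open>The algebra of a recurrent word\<close>

definition agree :: "(int \<Rightarrow> nat) \<Rightarrow> nat \<Rightarrow> int \<Rightarrow> int \<Rightarrow> bool"
  where "agree x n i j \<longleftrightarrow> (\<forall>m. \<bar>m\<bar> \<le> int n \<longrightarrow> x (i + m) = x (j + m))"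

definition window :: "(int \<Rightarrow> nat) \<Rightarrow> int \<Rightarrow> nat \<Rightarrow> nat list"
  where "window x i n = map (\<lambda>m. x (i + int m)) [0..<n]"

definition factors :: "(int \<Rightarrow> nat) \<Rightarrow> nat \<Rightarrow> nat list set"
  where "factors x n = range (\<lambda>i. window x i n)"

definition complexity :: "(int \<Rightarrow> nat) \<Rightarrow> nat \<Rightarrow> nat"
  where "complexity x n = card (factors x n)"

text \<open>Residues of positions modulo 4 are visible in the letters, which yields the matrix units.
  Uniform recurrence and aperiodicity give simplicity. Repetitions at distances that are powers of
  two exclude scalars from the span of the commutators in characteristic other than two.\<close>

locale recurrent_word =
  fixes x :: "int \<Rightarrow> nat" and Q :: nat
  assumes bounded: "x i < Q"
    and mod4: "int (x i) mod 4 = i mod 4"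
    and recurrent: "\<exists>N. \<forall>j. \<exists>d<N. agree x n i (j + int d)"
    and returns: "\<exists>i k. agree x n i (i + 2 ^ k)"
    and aperiodic: "l \<noteq> 0 \<Longrightarrow> \<exists>i. x (i + l) \<noteq> x i"
begin

text \<open>The sliding block codes of radius \<open>n\<close>. The positions are compared only through the letters
  around them, so these functions are the restrictions to the orbit of \<open>x\<close> of locally constant
  functions on its closure.\<close>

definition locally_determined :: "nat \<Rightarrow> (int \<Rightarrow> 'a::field) \<Rightarrow> bool"
  where "locally_determined n g \<longleftrightarrow> (\<forall>i j. agree x n i j \<longrightarrow> g i = g j)"

lemma agree_mono: "agree x n i j \<Longrightarrow> m \<le> n \<Longrightarrow> agree x m i j"
  by (auto simp: agree_def)

lemma agree_shift: "agree x n i j \<Longrightarrow> m + nat \<bar>k\<bar> \<le> n \<Longrightarrow> agree x m (i + k) (j + k)"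
  unfolding agree_def
proof (intro allI impI)
  fix t assume *: "\<forall>m. \<bar>m\<bar> \<le> int n \<longrightarrow> x (i + m) = x (j + m)" "m + nat \<bar>k\<bar> \<le> n" "\<bar>t\<bar> \<le> int m"
  then have "\<bar>k + t\<bar> \<le> int n" by linarith
  with *(1) show "x (i + k + t) = x (j + k + t)" by (simp add: add.assoc)
qed

lemma local_mono: "locally_determined m g \<Longrightarrow> m \<le> n \<Longrightarrow> locally_determined n g"
  using agree_mono unfolding locally_determined_def by blast

lemma local_const: "locally_determined n (\<lambda>_. c)"
  by (simp add: locally_determined_def)

lemma local_letter: "locally_determined (nat \<bar>m\<bar>) (\<lambda>t. if x (t + m) = c then 1 else 0)"
  unfolding locally_determined_def agree_def by auto

lemma local_shift: "locally_determined m g \<Longrightarrow> m + nat \<bar>k\<bar> \<le> n \<Longrightarrow> locally_determined n (\<lambda>i. g (i + k))"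
  using agree_shift unfolding locally_determined_def by blast

lemma local_agree: "locally_determined n (\<lambda>t. if agree x n s t then a else b)"
proof -
  have "agree x n s i = agree x n s j" if "agree x n i j" for i j
    using that by (auto simp: agree_def)
  then show ?thesis by (auto simp: locally_determined_def)
qed

definition band :: "nat \<Rightarrow> 'a::field endo set"
  where "band n = endo.span {weighted_shift g k | g k. \<bar>k\<bar> \<le> int n \<and> locally_determined n g}"

definition word_algebra :: "'a::field endo set"
  where "word_algebra = (\<Union>n. band n)"

lemma weighted_shift_in_band: "\<bar>k\<bar> \<le> int n \<Longrightarrow> locally_determined n g \<Longrightarrow> weighted_shift g k \<in> band n"
  unfolding band_def by (rule endo.span_base) auto

lemma weighted_shift_in_algebra: "locally_determined n g \<Longrightarrow> weighted_shift g k \<in> word_algebra"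
  unfolding word_algebra_def
  using weighted_shift_in_band[of k "n + nat \<bar>k\<bar>" g] local_mono[of n g "n + nat \<bar>k\<bar>"] by auto

lemma subspace_band: "endo.subspace (band n)"
  by (simp add: band_def)

lemma band_mono:
  assumes "m \<le> n"
  shows "band m \<subseteq> band n"
  unfolding band_def
proof (intro endo.span_mono Collect_mono impI)
  fix a :: "'a endo"
  assume "\<exists>g k. a = weighted_shift g k \<and> \<bar>k\<bar> \<le> int m \<and> locally_determined m g"
  then obtain g k where "a = weighted_shift g k" "\<bar>k\<bar> \<le> int m" "locally_determined m g" by auto
  then show "\<exists>g k. a = weighted_shift g k \<and> \<bar>k\<bar> \<le> int n \<and> locally_determined n g"
    using assms local_mono[of m g n] by (intro exI[of _ g] exI[of _ k]) auto
qed

lemma band_mult: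
  assumes "a \<in> band m" "b \<in> band n"
  shows "a * b \<in> band (m + n)"
proof (rule endo.mult_span_span[OF assms[unfolded band_def] subspace_band])
  fix a b :: "'a endo"
  assume "a \<in> {weighted_shift g k | g k. \<bar>k\<bar> \<le> int m \<and> locally_determined m g}"
    "b \<in> {weighted_shift g k | g k. \<bar>k\<bar> \<le> int n \<and> locally_determined n g}"
  then obtain g k h l where *: "a = weighted_shift g k" "\<bar>k\<bar> \<le> int m" "locally_determined m g"
    "b = weighted_shift h l" "\<bar>l\<bar> \<le> int n" "locally_determined n h" by auto
  have "locally_determined (m + n) g" using local_mono[OF *(3)] by simp
  moreover have "locally_determined (m + n) (\<lambda>i. h (i + k))"
      using local_shift[OF *(6), of k "m + n"] *(2) by simp
  ultimately have "locally_determined (m + n) (\<lambda>i. g i * h (i + k))"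
      by (auto simp: locally_determined_def)
  then show "a * b \<in> band (m + n)"
    unfolding *(1,4) weighted_shift_mult using *(2,5) by (intro weighted_shift_in_band) auto
qed

lemma band_commutator: "a \<in> band m \<Longrightarrow> b \<in> band n \<Longrightarrow> commutator a b \<in> band (m + n)"
  unfolding commutator_def using band_mult[of a m b n] band_mult[of b n a m]
  by (simp add: add.commute endo.subspace_diff[OF subspace_band])

lemma one_band: "1 \<in> band n"
  using weighted_shift_in_band[of 0 n "\<lambda>_. 1"] by (simp add: weighted_shift_one local_const)

lemma word_algebra_common_band:
  assumes "a \<in> word_algebra" "b \<in> word_algebra"
  obtains n where "a \<in> band n" "b \<in> band n"
proof -
  obtain m n where "a \<in> band m" "b \<in> band n" using assms by (auto simp: word_algebra_def)
  then have "a \<in> band (max m n)" "b \<in> band (max m n)"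
    using band_mono[of m "max m n"] band_mono[of n "max m n"] by auto
  then show ?thesis by (rule that)
qed

lemma band_subset: "band n \<subseteq> word_algebra"
  by (auto simp: word_algebra_def)

lemma subalg_word_algebra: "endo.subalg word_algebra"
  unfolding endo.subalg_def
proof (intro conjI ballI endo.subspaceI)
  show "0 \<in> word_algebra" using endo.subspace_0[OF subspace_band] band_subset by blast
  show "1 \<in> word_algebra" using one_band band_subset by blast
  fix a b :: "'a endo" assume "a \<in> word_algebra" "b \<in> word_algebra"
  then obtain n where n: "a \<in> band n" "b \<in> band n" by (rule word_algebra_common_band)
  show "a + b \<in> word_algebra" using endo.subspace_add[OF subspace_band n] band_subset by blast
  show "a * b \<in> word_algebra" using band_mult[OF n] band_subset by blast
next
  fix c and a :: "'a endo" assume "a \<in> word_algebra"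
  then obtain n where n: "a \<in> band n" by (auto simp: word_algebra_def)
  show "scale_endo c a \<in> word_algebra"
    using endo.subspace_scale[OF subspace_band n] band_subset by blast
qed

text \<open>The coefficient functions of an element are the diagonals of its matrix. Hence they do not
  depend on the way in which it is written as a combination of weighted shifts.\<close>

lemma band_entries:
  assumes "z \<in> band n"
  shows "locally_determined n (\<lambda>i. entry z i l)" and
      "z = (\<Sum>l\<in>{- int n..int n}. weighted_shift (\<lambda>i. entry z i l) l)"
    and "\<bar>l\<bar> > int n \<Longrightarrow> entry z i l = 0"
proof -
  have "(\<forall>l. locally_determined n (\<lambda>i. entry z i l)) \<and> (\<forall>l i. \<bar>l\<bar> > int n \<longrightarrow> entry z i l = 0) \<and>
      z = (\<Sum>l\<in>{- int n..int n}. weighted_shift (\<lambda>i. entry z i l) l)"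
    using assms[unfolded band_def]
  proof (induction rule: endo.span_induct_alt)
    case base
    show ?case by (simp add: local_const weighted_shift_zero)
  next
    case (step c a y)
    then obtain g k where a: "a = weighted_shift g k" "\<bar>k\<bar> \<le> int n" "locally_determined n g" by auto
    have 1: "locally_determined n (\<lambda>i. entry (scale_endo c a + y) i l)" for l
      using step(2) a(3)
          by (cases "l = k") (auto simp: a(1) entry_weighted_shift locally_determined_def)
    have 2: "entry (scale_endo c a + y) i l = 0" if "\<bar>l\<bar> > int n" for l i
      using step(2) a(2) that by (auto simp: a(1) entry_weighted_shift)
    have "(\<Sum>l\<in>{- int n..int n}. weighted_shift (\<lambda>i. entry a i l) l) =
        (\<Sum>l\<in>{- int n..int n}. if l = k then a else 0)"
      by (rule sum.cong) (auto simp: a(1) entry_weighted_shift weighted_shift_zero)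
    also have "\<dots> = a" using a(2) by auto
    finally have 3: "(\<Sum>l\<in>{- int n..int n}. weighted_shift (\<lambda>i. entry a i l) l) = a" .
    have "(\<Sum>l\<in>{- int n..int n}. weighted_shift (\<lambda>i. entry (scale_endo c a + y) i l) l) =
       (\<Sum>l\<in>{- int n..int n}. scale_endo c (weighted_shift (\<lambda>i. entry a i l) l)
          + weighted_shift (\<lambda>i. entry y i l) l)"
      by (simp add: weighted_shift_add weighted_shift_scale)
    also have "\<dots> = scale_endo c (\<Sum>l\<in>{- int n..int n}. weighted_shift (\<lambda>i. entry a i l) l)
          + (\<Sum>l\<in>{- int n..int n}. weighted_shift (\<lambda>i. entry y i l) l)"
      by (simp only: sum.distrib endo.scale_sum_right)
    also have "\<dots> = scale_endo c a + y" using 3 step(2) by metis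
    finally show ?case using 1 2 by auto
  qed
  then show "locally_determined n (\<lambda>i. entry z i l)" and
      "z = (\<Sum>l\<in>{- int n..int n}. weighted_shift (\<lambda>i. entry z i l) l)"
    and "\<bar>l\<bar> > int n \<Longrightarrow> entry z i l = 0" by blast+
qed

lemma entry_determines:
  assumes "z \<in> word_algebra" "\<And>i l. entry z i l = 0"
  shows "z = 0"
proof -
  obtain n where "z \<in> band n" using assms(1) by (auto simp: word_algebra_def)
  from band_entries(2)[OF this] show ?thesis by (simp add: assms(2) weighted_shift_zero)
qed

section \<open>Matrix units in the algebra of a word\<close>

definition matrix_unit :: "nat \<Rightarrow> nat \<Rightarrow> 'a::field endo"
  where "matrix_unit i j = weighted_shift (\<lambda>t. if t mod 4 = int i then 1 else 0) (int j - int i)"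

lemma local_mod4: "locally_determined n (\<lambda>t. if t mod 4 = c then a else b)"
proof -
  have "i mod 4 = j mod 4" if "agree x n i j" for i j
  proof -
    have "x i = x j" using that by (auto simp: agree_def dest: spec[of _ 0])
    then show ?thesis by (metis mod4)
  qed
  then show ?thesis by (auto simp: locally_determined_def)
qed

lemma unit_in_band: "i < 4 \<Longrightarrow> j < 4 \<Longrightarrow> matrix_unit i j \<in> band 3"
  unfolding matrix_unit_def by (intro weighted_shift_in_band local_mod4) auto

lemma mod4_shift:
  assumes "i < 4" "j < 4" "k < 4"
  shows "t mod 4 = int i \<Longrightarrow> (t + (int j - int i)) mod 4 = int k \<longleftrightarrow> j = k"
proof -
  assume "t mod 4 = int i"
  then obtain q where "t = 4 * q + int i" by (metis mult_div_mod_eq)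
  then have "(t + (int j - int i)) mod 4 = int j" using assms by (simp add: algebra_simps)
  then show ?thesis by auto
qed

lemma unit_mult:
  assumes "i < 4" "j < 4" "k < 4" "l < 4"
  shows "matrix_unit i j * matrix_unit k l = (if j = k then matrix_unit i l else 0)"
proof -
  have "(\<lambda>t. (if t mod 4 = int i then 1 else 0) *
      (if (t + (int j - int i)) mod 4 = int k then 1 else 0)) =
      (\<lambda>t. if j = k then if t mod 4 = int i then 1 else (0::'a) else 0)"
    using mod4_shift[OF assms(1-3)] by (auto simp: fun_eq_iff)
  then show ?thesis by (auto simp: matrix_unit_def weighted_shift_mult weighted_shift_zero)
qed

lemma unit_sum: "(\<Sum>i<4. matrix_unit i i) = 1"
proof -
  have "(\<Sum>i<4. matrix_unit i i) = weighted_shift (\<lambda>t. \<Sum>i<4. if t mod 4 = int i then 1 else 0) 0"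
    by (simp add: matrix_unit_def weighted_shift_sum)
  also have "(\<lambda>t. \<Sum>i<4. if t mod 4 = int i then 1 else (0::'a)) = (\<lambda>t. 1)"
  proof
    fix t :: int
    have "(\<Sum>i<4::nat. if t mod 4 = int i then 1 else (0::'a))
        = (\<Sum>i<4::nat. if i = nat (t mod 4) then 1 else (0::'a))"
      by (rule sum.cong) (auto simp: nat_eq_iff)
    also have "\<dots> = 1" by (simp add: nat_less_iff)
    finally show "(\<Sum>i<4::nat. if t mod 4 = int i then 1 else (0::'a)) = 1" .
  qed
  finally show ?thesis by (simp add: weighted_shift_one)
qed

sublocale matrix_algebra scale_endo word_algebra matrix_unit
proof unfold_locales
  show "matrix_unit i j \<in> word_algebra" if "i < 4" "j < 4" for i j
    using unit_in_band[OF that] band_subset by blast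
qed (simp_all add: subalg_word_algebra unit_mult unit_sum)

section \<open>Simplicity of the algebra of a word\<close>

definition support :: "'a::field endo \<Rightarrow> int set"
  where "support z = {l. \<exists>i. entry z i l \<noteq> 0}"

lemma finite_support: "z \<in> word_algebra \<Longrightarrow> finite (support z)"
proof -
  assume "z \<in> word_algebra"
  then obtain n where n: "z \<in> band n" by (auto simp: word_algebra_def)
  have "support z \<subseteq> {- int n..int n}"
  proof
    fix l assume "l \<in> support z"
    then obtain i where "entry z i l \<noteq> 0" by (auto simp: support_def)
    then have "\<not> \<bar>l\<bar> > int n" using band_entries(3)[OF n] by blast
    then show "l \<in> {- int n..int n}" by auto
  qed
  then show ?thesis by (rule finite_subset) simp
qed

text \<open>Choose a nonzero element of the ideal with the fewest nonzero diagonals, and shift it so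
  that the main diagonal is one of them. A commutator with a diagonal operator \<open>h\<close> loses the main
  diagonal, so it vanishes by minimality. If diagonal \<open>l\<close> had a nonzero entry in row \<open>i\<close>, this
  would give \<open>h i = h (i + l)\<close> for all locally determined \<open>h\<close>, and \<open>l\<close> would be a period of \<open>x\<close>.\<close>

lemma ideal_contains_diagonal:
  assumes J: "J \<subseteq> word_algebra" "endo.subspace J"
    and ideal: "\<And>r y. r \<in> word_algebra \<Longrightarrow> y \<in> J \<Longrightarrow> r * y \<in> J \<and> y * r \<in> J"
    and y0: "y0 \<in> J" "y0 \<noteq> 0"
  shows "\<exists>n g s. locally_determined n g \<and> weighted_shift g 0 \<in> J \<and> g s \<noteq> 0"
proof -
  obtain y where y: "y \<in> J" "y \<noteq> 0"
    and min: "\<And>z. z \<in> J \<Longrightarrow> card (support z) < card (support y) \<Longrightarrow> z = 0"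
  proof -
    let ?P = "\<lambda>z. z \<in> J \<and> z \<noteq> 0"
    have "?P (arg_min (\<lambda>z. card (support z)) ?P)"
      by (rule arg_min_natI[of ?P y0]) (use y0 in simp)
    moreover have "z = 0" if "z \<in> J"
      "card (support z) < card (support (arg_min (\<lambda>z. card (support z)) ?P))" for z
      using arg_min_nat_le[of ?P z "\<lambda>z. card (support z)"] that by fastforce
    ultimately show ?thesis using that by blast
  qed
  obtain i0 l0 where "entry y i0 l0 \<noteq> 0" using entry_determines y J(1) by blast
  define w where "w = y * weighted_shift (\<lambda>_. 1) (- l0)"
  have wJ: "w \<in> J" unfolding w_def
    using ideal[OF weighted_shift_in_algebra[OF local_const] y(1)] by blast
  have entry_w: "entry w i l = entry y i (l + l0)" for i l by (simp add: w_def entry_shift_right)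
  have w0: "entry w i0 0 \<noteq> 0" using \<open>entry y i0 l0 \<noteq> 0\<close> by (simp add: entry_w)
  have "support w = (\<lambda>l. l - l0) ` support y"
  proof (rule set_eqI)
    fix l
    have "l \<in> support w \<longleftrightarrow> l + l0 \<in> support y" by (simp add: support_def entry_w)
    also have "\<dots> \<longleftrightarrow> l \<in> (\<lambda>l. l - l0) ` support y"
      by (auto simp: image_iff intro: bexI[of _ "l + l0"])
    finally show "l \<in> support w \<longleftrightarrow> l \<in> (\<lambda>l. l - l0) ` support y" .
  qed
  then have card_w: "card (support w) = card (support y)" by (simp add: card_image inj_on_def)
  have wA: "w \<in> word_algebra" using wJ J(1) by auto
  have diag: "entry w i l = 0" if l: "l \<noteq> 0" for i l
  proof (rule ccontr)
    assume w: "entry w i l \<noteq> 0"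
    have "x (i + l + m) = x (i + m)" for m
    proof -
      define h :: "int \<Rightarrow> 'a" where "h = (\<lambda>t. if x (t + m) = x (i + m) then 1 else 0)"
      have hA: "weighted_shift h 0 \<in> word_algebra"
        unfolding h_def by (rule weighted_shift_in_algebra[OF local_letter])
      define v where "v = weighted_shift h 0 * w - w * weighted_shift h 0"
      have "v \<in> J" unfolding v_def using ideal[OF hA wJ] J(2) endo.subspace_diff by blast
      have entry_v: "entry v i l = entry w i l * (h i - h (i + l))" for i l
        by (simp add: v_def entry_shift_left entry_shift_right algebra_simps)
      have "support v \<subseteq> support w - {0}" by (auto simp: support_def entry_v)
      moreover have "0 \<in> support w" using w0 by (auto simp: support_def)
      ultimately have "support v \<subset> support w" by blast
      then have "card (support v) < card (support y)"
        using psubset_card_mono[OF finite_support[OF wA]] card_w by auto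
      then have "v = 0" using min \<open>v \<in> J\<close> by blast
      then have "h i = h (i + l)" using entry_v[of i l] w by simp
      then show ?thesis by (auto simp: h_def split: if_splits)
    qed
    then have "x (t + l) = x t" for t
      by (metis (no_types, opaque_lifting) add.commute add.left_commute diff_add_cancel)
    then show False using aperiodic[OF l] by auto
  qed
  obtain n where n: "w \<in> band n" using wA by (auto simp: word_algebra_def)
  have "w = (\<Sum>l\<in>{- int n..int n}. if l = 0 then weighted_shift (\<lambda>i. entry w i 0) 0 else 0)"
    by (subst band_entries(2)[OF n]) (rule sum.cong, auto simp: diag weighted_shift_zero)
  also have "\<dots> = weighted_shift (\<lambda>i. entry w i 0) 0" by auto
  finally have "weighted_shift (\<lambda>i. entry w i 0) 0 \<in> J" using wJ by simp
  with band_entries(1)[OF n, of 0] w0 show ?thesis by blast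
qed

text \<open>Multiplying a diagonal element of the ideal by a suitable locally determined function gives
  the indicator \<open>chi\<close> of the occurrences of one window. By uniform recurrence finitely many
  translates of that set cover the integers. Then \<open>1 - (\<Prod>d<N. 1 - chi (i + d))\<close>, which has its
  values in the ideal, is identically \<open>1\<close>.\<close>

lemma simple_word_algebra: "endo.simple_subalg (word_algebra :: 'a::field endo set)"
  unfolding endo.simple_subalg_def
proof (intro allI impI)
  fix J :: "'a endo set"
  assume J: "J \<subseteq> word_algebra" "endo.subspace J"
    and id: "\<forall>r\<in>word_algebra. \<forall>y\<in>J. r * y \<in> J \<and> y * r \<in> J"
  note ideal = id[rule_format]
  show "J = {0} \<or> 1 \<in> J"
  proof (cases "J = {0}")
    case False
    then obtain y0 where "y0 \<in> J" "y0 \<noteq> 0" using endo.subspace_0[OF J(2)] by auto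
    from ideal_contains_diagonal[OF J ideal this]
    obtain n g s where g: "locally_determined n g" "weighted_shift g 0 \<in> J" "g s \<noteq> 0" by blast
    define chi :: "int \<Rightarrow> 'a" where "chi = (\<lambda>t. if agree x n s t then 1 else 0)"
    have "weighted_shift (\<lambda>t. if agree x n s t then inverse (g s) else 0) 0 * weighted_shift g 0
        \<in> J"
      using ideal[OF weighted_shift_in_algebra[OF local_agree] g(2)] by blast
    moreover have "(\<lambda>t. (if agree x n s t then inverse (g s) else 0) * g t) = chi"
      using g(1,3) by (auto simp: chi_def locally_determined_def fun_eq_iff)
    ultimately have chi: "weighted_shift chi 0 \<in> J" by (simp add: weighted_shift_mult)
    have chi_shift: "weighted_shift (\<lambda>t. chi (t + k)) 0 \<in> J" for k
    proof -
      have "weighted_shift (\<lambda>_. 1) k * weighted_shift chi 0 * weighted_shift (\<lambda>_. 1) (- k) \<in> J"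
        using ideal chi weighted_shift_in_algebra[OF local_const] by blast
      then show ?thesis by (simp add: weighted_shift_mult)
    qed
    have "\<exists>q. weighted_shift q 0 \<in> J \<and> (\<forall>i. (\<exists>d<N. agree x n s (i + int d)) \<longrightarrow> q i = 1)" for N
    proof (induction N)
      case 0
      show ?case
        using endo.subspace_0[OF J(2)] by (intro exI[of _ "\<lambda>_. 0"]) (simp add: weighted_shift_zero)
    next
      case (Suc N)
      then obtain q where q: "weighted_shift q 0 \<in> J"
        "\<And>i. (\<exists>d<N. agree x n s (i + int d)) \<Longrightarrow> q i = 1" by blast
      let ?q = "\<lambda>i. q i + (chi (i + int N) + (- 1) * (q i * chi (i + int N)))"
      have "weighted_shift ?q 0 = weighted_shift q 0 + (weighted_shift (\<lambda>t. chi (t + int N)) 0 +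
          scale_endo (- 1) (weighted_shift q 0 * weighted_shift (\<lambda>t. chi (t + int N)) 0))"
        by (simp only: weighted_shift_add weighted_shift_scale weighted_shift_mult add_0_right
            add_0_left)
      moreover have "weighted_shift q 0 * weighted_shift (\<lambda>t. chi (t + int N)) 0 \<in> J"
        using ideal[of "weighted_shift q 0" "weighted_shift (\<lambda>t. chi (t + int N)) 0"]
          chi_shift q(1) J(1) by blast
      ultimately have "weighted_shift ?q 0 \<in> J"
        using q(1) chi_shift[of "int N"]
        by (simp only: endo.subspace_add[OF J(2)] endo.subspace_scale[OF J(2)])
      moreover have "?q i = 1" if "\<exists>d<Suc N. agree x n s (i + int d)" for i
      proof (cases "agree x n s (i + int N)")
        case True
        then show ?thesis by (simp add: chi_def)
      next
        case False
        then have "\<exists>d<N. agree x n s (i + int d)" using that less_Suc_eq by auto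
        then show ?thesis using q(2) False by (simp add: chi_def)
      qed
      ultimately show ?case by blast
    qed
    moreover obtain N where "\<And>j. \<exists>d<N. agree x n s (j + int d)" using recurrent by blast
    ultimately obtain q where "weighted_shift q 0 \<in> J" "\<And>i. q i = 1" by meson
    then have "weighted_shift (\<lambda>_. 1) 0 \<in> J" by (metis ext)
    then show ?thesis by (simp add: weighted_shift_one)
  qed simp
qed

section \<open>The centre meets the commutators trivially\<close>

text \<open>An invariant probability measure on the orbit closure of \<open>x\<close> would give a trace, but its
  real values have no meaning in a field of positive characteristic. Sums over the stretch between
  two places that look alike take its part.\<close>

definition balanced :: "(int \<Rightarrow> 'a::field) \<Rightarrow> bool"
  where "balanced d \<longleftrightarrow> (\<exists>n. \<forall>i N. agree x n i (i + int N) \<longrightarrow> (\<Sum>t<N. d (i + int t)) = 0)"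

text \<open>Moving the stretch one step to the right replaces the value of \<open>H\<close> at one of its ends by the
  value at the other end, and these are equal as long as the windows around the ends agree. So the
  sum of \<open>H\<close> is the same over the stretch and over its translate by \<open>k\<close>.\<close>

lemma balanced_coboundary:
  fixes H :: "int \<Rightarrow> 'a::field"
  assumes "locally_determined n H"
  shows "balanced (\<lambda>i. H i - H (i + k))"
  unfolding balanced_def
proof (intro exI[of _ "n + nat \<bar>k\<bar>"] allI impI)
  fix i N assume ag: "agree x (n + nat \<bar>k\<bar>) i (i + int N)"
  define S where "S j = (\<Sum>t<N. H (j + int t))" for j
  have step: "S (j + 1) = S j" if "\<bar>j - i\<bar> \<le> \<bar>k\<bar>" for j
  proof -
    have "S (j + 1) - S j = (\<Sum>t<N. H (j + int (Suc t)) - H (j + int t))"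
      by (simp add: S_def sum_subtractf algebra_simps)
    also have "\<dots> = H (j + int N) - H j" by (subst sum_lessThan_telescope) simp
    also have "\<dots> = 0"
    proof -
      have "agree x n (i + (j - i)) (i + int N + (j - i))"
        by (rule agree_shift[OF ag]) (use that in linarith)
      then have "agree x n j (j + int N)" by (simp add: algebra_simps)
      then show ?thesis using assms by (simp add: locally_determined_def)
    qed
    finally show ?thesis by simp
  qed
  have up: "S (i + int m) = S i" if "int m \<le> \<bar>k\<bar>" for m
    using that
  proof (induction m)
    case (Suc m)
    then show ?case using step[of "i + int m"] by (simp add: algebra_simps)
  qed simp
  have down: "S (i - int m) = S i" if "int m \<le> \<bar>k\<bar>" for m
    using that
  proof (induction m)
    case (Suc m)
    then show ?case using step[of "i - int (Suc m)"] by (simp add: algebra_simps)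
  qed simp
  have "S (i + k) = S i"
    using up[of "nat k"] down[of "nat (- k)"] by (cases "k \<ge> 0") auto
  then show "(\<Sum>t<N. H (i + int t) - H (i + int t + k)) = 0"
    by (simp add: S_def sum_subtractf algebra_simps)
qed

lemma balanced_zero: "balanced (\<lambda>_. 0)"
  by (simp add: balanced_def)

lemma balanced_add:
  assumes "balanced d" "balanced e"
  shows "balanced (\<lambda>i. d i + e i)"
proof -
  obtain m n where "\<And>i N. agree x m i (i + int N) \<Longrightarrow> (\<Sum>t<N. d (i + int t)) = 0"
    "\<And>i N. agree x n i (i + int N) \<Longrightarrow> (\<Sum>t<N. e (i + int t)) = 0"
    using assms unfolding balanced_def by metis
  then have "(\<Sum>t<N. d (i + int t) + e (i + int t)) = 0" if "agree x (max m n) i (i + int N)" for i N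
    using agree_mono[OF that, of m] agree_mono[OF that, of n] by (simp add: sum.distrib)
  then show ?thesis unfolding balanced_def by blast
qed

lemma balanced_scale: "balanced d \<Longrightarrow> balanced (\<lambda>i. c * d i)"
  unfolding balanced_def by (simp flip: sum_distrib_left) fastforce

lemma subspace_balanced: "endo.subspace {z. balanced (\<lambda>i. entry z i 0)}"
  by (rule endo.subspaceI) (simp_all add: balanced_zero balanced_add balanced_scale)

text \<open>The main diagonal of the commutator of two weighted shifts in opposite directions has the
  form \<open>H i - H (i - k)\<close>.\<close>

lemma balanced_commutator_shift:
  assumes "locally_determined m g" "locally_determined n h"
  shows "balanced (\<lambda>i. entry (commutator (weighted_shift g k) (weighted_shift h l)) i 0)"
proof (cases "k + l = 0")
  case False
  then show ?thesis
    by (simp add: commutator_def weighted_shift_mult entry_weighted_shift add.commute balanced_zero)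
next
  case True
  then have l: "l = - k" by simp
  define H where "H = (\<lambda>i. g i * h (i + k))"
  have "locally_determined (m + (n + nat \<bar>k\<bar>)) g"
      "locally_determined (m + (n + nat \<bar>k\<bar>)) (\<lambda>i. h (i + k))"
    using assms local_mono[of m g] local_shift[of n h k] by auto
  then have "locally_determined (m + (n + nat \<bar>k\<bar>)) H" by (auto simp: locally_determined_def H_def)
  from balanced_coboundary[OF this, of "- k"] show ?thesis
    by (simp add: commutator_def weighted_shift_mult entry_weighted_shift l H_def mult.commute)
qed

lemma balanced_derived:
  fixes z :: "'a::field endo"
  assumes "z \<in> endo.derived word_algebra"
  shows "balanced (\<lambda>i. entry z i 0)"
proof -
  let ?B = "{z :: 'a endo. balanced (\<lambda>i. entry z i 0)}"
  have 1: "commutator a (weighted_shift h l) \<in> ?B"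
      if a: "a \<in> word_algebra" and h: "locally_determined n h"
    for a :: "'a endo" and h n l
  proof -
    obtain m where "a \<in> band m" using a by (auto simp: word_algebra_def)
    then show ?thesis
      unfolding band_def
    proof (induction rule: endo.span_induct_alt)
      case base
      show ?case using endo.subspace_0[OF subspace_balanced] by simp
    next
      case (step c a y)
      then obtain g k where "a = weighted_shift g k" "locally_determined m g" by auto
      then have "commutator a (weighted_shift h l) \<in> ?B"
        using balanced_commutator_shift[OF _ h] by simp
      then show ?case using step(2) unfolding commutator_add_left endo.commutator_scale_left
        by (intro endo.subspace_add[OF subspace_balanced] endo.subspace_scale[OF subspace_balanced])
    qed
  qed
  have "commutator a b \<in> ?B" if a: "a \<in> word_algebra" and b: "b \<in> word_algebra"
    for a b :: "'a endo"
  proof -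
    obtain m where "b \<in> band m" using b by (auto simp: word_algebra_def)
    then show ?thesis
      unfolding band_def
    proof (induction rule: endo.span_induct_alt)
      case base
      show ?case using endo.subspace_0[OF subspace_balanced] by simp
    next
      case (step c b y)
      then obtain g k where "b = weighted_shift g k" "locally_determined m g" by auto
      then have "commutator a b \<in> ?B" using 1[OF a] by simp
      then show ?case using step(2) unfolding commutator_add_right endo.commutator_scale_right
        by (intro endo.subspace_add[OF subspace_balanced] endo.subspace_scale[OF subspace_balanced])
    qed
  qed
  then have "endo.derived word_algebra \<subseteq> ?B"
    unfolding endo.derived_def by (intro endo.span_minimal subspace_balanced) auto
  then show ?thesis using assms by auto
qed

text \<open>A central element commutes with the shift, so each of its diagonals is constant, and with
  the indicators of the letters, so by aperiodicity only the main diagonal can be nonzero. The sum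
  of the latter over a stretch of length \<open>2 ^ k\<close> between places that look alike is zero.\<close>

lemma derived_centre_trivial:
  fixes z :: "'a::field endo"
  assumes two: "(2::'a) \<noteq> 0" and z: "z \<in> endo.derived word_algebra"
    and central: "\<And>r. r \<in> word_algebra \<Longrightarrow> z * r = r * z"
  shows "z = 0"
proof (rule entry_determines)
  show "z \<in> word_algebra" using z endo.derived_subset[OF subalg_word_algebra] by auto
  have step: "entry z (i + 1) l = entry z i l" for i l
  proof -
    have "entry (z * weighted_shift (\<lambda>_. 1) 1) i (l + 1)
        = entry (weighted_shift (\<lambda>_. 1) 1 * z) i (l + 1)"
      using central[OF weighted_shift_in_algebra[OF local_const]] by simp
    then show ?thesis by (simp add: entry_shift_left entry_shift_right)
  qed
  have const: "entry z i l = entry z 0 l" for i l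
  proof (induction i rule: int_induct[of _ 0])
    case base show ?case by simp
  next
    case (step1 i) then show ?case using step[of i l] by simp
  next
    case (step2 i) then show ?case using step[of "i - 1" l] by simp
  qed
  show "entry z i l = 0" for i l
  proof (cases "l = 0")
    case False
    obtain t where t: "x (t + l) \<noteq> x t" using aperiodic[OF False] by auto
    let ?h = "\<lambda>s. if x (s + 0) = x t then 1 else (0::'a)"
    have "z * weighted_shift ?h 0 = weighted_shift ?h 0 * z"
      by (rule central[OF weighted_shift_in_algebra[OF local_letter]])
    from arg_cong[OF this, of "\<lambda>r. entry r t l"]
    have "entry z t l = 0" using t by (simp add: entry_shift_left entry_shift_right)
    then show ?thesis using const by metis
  next
    case True
    obtain n where n: "\<And>i N. agree x n i (i + int N) \<Longrightarrow> (\<Sum>t<N. entry z (i + int t) 0) = 0"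
      using balanced_derived[OF z] unfolding balanced_def by blast
    obtain i' k where "agree x n i' (i' + 2 ^ k)" using returns by blast
    then have "(\<Sum>t<(2::nat) ^ k. entry z (i' + int t) 0) = 0" by (intro n) simp
    then have "of_nat (2 ^ k) * entry z 0 0 = 0" by (subst (asm) const) simp
    then have "entry z 0 0 = 0" using two by simp
    then show ?thesis using const[of i 0] True by simp
  qed
qed

end

section \<open>Models of the Lie algebra on polynomials\<close>

lemma vector_space_smult: "vector_space (smult :: 'a::field \<Rightarrow> 'a poly \<Rightarrow> 'a poly)"
  by unfold_locales (simp_all add: smult_add_right smult_add_left)

text \<open>A basis of \<open>L\<close> meets each of the countably many finite-dimensional spaces in a finite set,
  so it is countable, and the monomials can be mapped to it bijectively.\<close>

lemma (in vector_space) poly_isomorphism: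
  assumes L: "subspace L" and T: "L \<subseteq> (\<Union>n. span (T n))" "\<And>n::nat. finite (T n)"
    and inf: "\<And>n. \<exists>B\<subseteq>L. independent B \<and> n < card B"
  shows "\<exists>\<phi> :: 'a poly \<Rightarrow> 'b. module_hom smult scale \<phi> \<and> inj \<phi> \<and> range \<phi> = L"
proof -
  obtain B where B: "B \<subseteq> L" "independent B" "L \<subseteq> span B"
    by (rule maximal_independent_subset)
  have "infinite B"
  proof
    assume fin: "finite B"
    obtain C where C: "C \<subseteq> L" "independent C" "card B < card C" using inf by blast
    from C(1) B(3) have "C \<subseteq> span B" by (rule subset_trans)
    then show False using independent_span_bound[OF fin C(2)] C(3) by auto
  qed
  have "countable B"
  proof -
    have "finite (B \<inter> span (T n))" for n
      using independent_span_bound[OF T(2), of "B \<inter> span (T n)" n] independent_mono[OF B(2)] by auto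
    then have "countable (\<Union>n. B \<inter> span (T n))"
        by (intro countable_UN) (auto intro: countable_finite)
    moreover have "B = (\<Union>n. B \<inter> span (T n))" using B(1) T(1) by auto
    ultimately show ?thesis by simp
  qed
  define b where "b = from_nat_into B"
  have b: "inj b" "range b = B"
    using bij_betw_from_nat_into[OF \<open>countable B\<close> \<open>infinite B\<close>] by (auto simp: b_def bij_betw_def)
  define \<phi> where "\<phi> p = (\<Sum>i\<le>degree p. scale (coeff p i) (b i))" for p
  have phi: "\<phi> p = (\<Sum>i\<le>n. scale (coeff p i) (b i))" if "degree p \<le> n" for p n
    unfolding \<phi>_def by (rule sum.mono_neutral_left) (use that in \<open>auto simp: coeff_eq_0\<close>)
  have hom: "module_hom smult scale \<phi>"
    unfolding module_hom_iff
  proof (intro conjI allI)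
    show "module (smult :: 'a \<Rightarrow> 'a poly \<Rightarrow> 'a poly)"
      using vector_space_smult by (simp add: module_iff_vector_space)
    show "module scale" by (rule module_axioms)
    show "\<phi> (p + q) = \<phi> p + \<phi> q" for p q
      using phi[of "p + q" "max (degree p) (degree q)"] phi[of p "max (degree p) (degree q)"]
        phi[of q "max (degree p) (degree q)"] degree_add_le_max[of p q]
      by (simp add: scale_left_distrib sum.distrib)
    show "\<phi> (smult c p) = scale c (\<phi> p)" for c p
      using phi[of "smult c p" "degree p"] degree_smult_le[of c p]
      by (simp add: \<phi>_def[of p] scale_sum_right)
  qed
  interpret module_hom smult scale \<phi> by (rule hom)
  have "inj \<phi>"
    unfolding inj_iff_eq_0
  proof (intro allI impI)
    fix p assume "\<phi> p = 0"
    then have "(\<Sum>v\<in>b ` {..degree p}. scale (coeff p (inv b v)) v) = 0"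
      using b(1) by (subst sum.reindex) (auto simp: \<phi>_def inj_on_def)
    moreover have "b ` {..degree p} \<subseteq> B" using b(2) by auto
    ultimately have "coeff p (inv b v) = 0" if "v \<in> b ` {..degree p}" for v
      using independentD[OF B(2), of "b ` {..degree p}" "\<lambda>v. coeff p (inv b v)" v] that by auto
    from this[of "b (degree p)"] have "coeff p (degree p) = 0" using b(1) by simp
    then show "p = 0" by simp
  qed
  moreover have "range \<phi> = L"
  proof
    show "range \<phi> \<subseteq> L"
      using B(1) b(2) unfolding \<phi>_def by (auto intro!: subspace_sum[OF L] subspace_scale[OF L])
    have "b i \<in> range \<phi>" for i
    proof -
      have "\<phi> (monom 1 i) = (\<Sum>j\<le>i. scale (if i = j then 1 else 0) (b j))"
        by (simp add: \<phi>_def degree_monom_eq)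
      also have "\<dots> = (\<Sum>j\<le>i. if i = j then b j else 0)" by (rule sum.cong) auto
      also have "\<dots> = b i" by simp
      finally show ?thesis by (metis rangeI)
    qed
    then have "B \<subseteq> range \<phi>" using b(2) by auto
    then have "span B \<subseteq> range \<phi>"
      by (rule span_minimal) (rule subspace_image[OF m1.subspace_UNIV])
    then show "L \<subseteq> range \<phi>" using B(3) by (rule subset_trans[rotated])
  qed
  ultimately show ?thesis using hom by blast
qed

lemma (in assoc_algebra) derived_model_lie_algebra:
  assumes R: "subalg R" and scl: "vector_space scl" and hom: "module_hom scl scale \<phi>"
    and inj: "inj \<phi>" and range: "range \<phi> = derived R"
    and br: "br = (\<lambda>p q. inv \<phi> (commutator (\<phi> p) (\<phi> q)))"
  shows "lie_algebra scl br" and "\<phi> (br p q) = commutator (\<phi> p) (\<phi> q)"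
proof -
  interpret module_hom scl scale \<phi> by (rule hom)
  have "\<phi> p \<in> R" for p using range derived_subset[OF R] by auto
  then have "commutator (\<phi> p) (\<phi> q) \<in> range \<phi>" for p q
    by (simp add: range commutator_in_derived)
  then have br': "\<phi> (br p q) = commutator (\<phi> p) (\<phi> q)" for p q
    unfolding br by (rule f_inv_into_f)
  then show "\<phi> (br p q) = commutator (\<phi> p) (\<phi> q)" .
  show "lie_algebra scl br"
    unfolding lie_algebra_def lie_algebra_axioms_def
  proof (intro conjI allI scl; rule injD[OF inj])
  qed (simp_all add: br' add zero local.scale commutator_add_left commutator_add_right
      commutator_scale_left commutator_scale_right, simp_all add: commutator_def algebra_simps)
qed

text \<open>A Lie algebra on a whole type that is identified with \<open>[R, R]\<close> by an isomorphism \<open>\<phi>\<close>.\<close>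

locale derived_model = matrix_algebra scale R E + L: lie_algebra scl br
  for scale :: "'a::field \<Rightarrow> 'r::ring_1 \<Rightarrow> 'r" and R E
    and scl :: "'a \<Rightarrow> 'b::ab_group_add \<Rightarrow> 'b" and br +
  fixes \<phi> :: "'b \<Rightarrow> 'r"
  assumes hom: "module_hom scl scale \<phi>" and inj: "inj \<phi>" and range: "range \<phi> = derived R"
    and br: "\<phi> (br p q) = commutator (\<phi> p) (\<phi> q)"
begin

sublocale phi: module_hom scl scale \<phi> by (rule hom)

lemma derived_in_image: "r \<in> derived R \<Longrightarrow> \<exists>p. \<phi> p = r"
  using range by (metis imageE)

lemma image_subset_derived: "\<phi> ` S \<subseteq> derived R"
  using range by auto

lemma unit_nonzero: "E 0 0 \<noteq> 0"
proof
  assume "E 0 0 = 0"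
  then have "E i i = 0" if "i < 4" for i
    using E_mult[of i 0 0 i] E_mult[of i 0 0 0] that by simp
  then have "(\<Sum>i<4. E i i) = 0" by simp
  then show False by (simp add: E_sum)
qed

lemma simple_derived_model:
  assumes "simple_subalg R" and two: "(2::'a) \<noteq> 0"
    and centre: "\<And>z. z \<in> derived R \<Longrightarrow> (\<And>r. r \<in> R \<Longrightarrow> z * r = r * z) \<Longrightarrow> z = 0"
  shows "L.simple"
  unfolding L.simple_def
proof (intro conjI allI impI)
  obtain p q where pq: "\<phi> p = E 0 1" "\<phi> q = E 1 0"
    using derived_in_image corner_in_derived[OF corner_E] by (metis one_less_numeral_iff
      semiring_norm(76) zero_less_numeral zero_neq_one)
  have "\<phi> (br p q) * E 0 0 = E 0 0" by (simp add: br pq commutator_def E_mult left_diff_distrib)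
  then have "br p q \<noteq> 0" using unit_nonzero phi.zero by auto
  then show "\<exists>p q. br p q \<noteq> 0" by blast
  fix I assume "L.ideal I"
  then have I: "L.subspace I" "\<And>p q. q \<in> I \<Longrightarrow> br p q \<in> I" by (auto simp: L.ideal_def)
  have "commutator r y \<in> \<phi> ` I" if r: "r \<in> derived R" and y: "y \<in> \<phi> ` I" for r y
  proof -
    obtain p q where "r = \<phi> p" "y = \<phi> q" "q \<in> I" using y derived_in_image[OF r] by blast
    then show ?thesis using I(2) by (simp flip: br)
  qed
  from derived_simple[OF assms(1) two centre phi.subspace_image[OF I(1)] image_subset_derived this]
  have "\<phi> ` I = \<phi> ` {0} \<or> \<phi> ` I = \<phi> ` UNIV" by (simp add: range)
  then show "I = {0} \<or> I = UNIV" unfolding inj_image_eq_iff[OF inj] .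
qed

context
  fixes G :: "'r set"
  assumes fin_G: "finite G" and G: "G \<subseteq> R" and R_gen: "R \<subseteq> span {prod_list gs |gs. set gs \<subseteq> G}"
begin

text \<open>The generators of \<open>R\<close> themselves may lie on the diagonal. Flanking them by all matrix units
  that make the result off-diagonal loses no information, and keeps a product of \<open>n\<close> generators a
  Lie product of \<open>n\<close> elements.\<close>

definition corner_gens :: "'r set"
  where "corner_gens = {E l a * g * E b k |l a g b k. l < 4 \<and> a < 4 \<and> b < 4 \<and> k < 4 \<and> l \<noteq> k \<and> g
      \<in> G}"

definition gens :: "'b set"
  where "gens = L.span (\<phi> -` corner_gens)"

lemma corner_gens_subset: "corner_gens \<subseteq> derived R"
  unfolding corner_gens_def using corner_in_derived[OF cornerI] G by blast

lemma finite_corner_gens: "finite corner_gens"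
proof -
  have "corner_gens \<subseteq> (\<lambda>(l, a, g, b, k). E l a * g * E b k) ` ({..<4} \<times> {..<4} \<times> G \<times> {..<4}
      \<times> {..<4})"
    unfolding corner_gens_def by (auto simp: image_iff) blast
  then show ?thesis by (rule finite_subset) (use fin_G in auto)
qed

lemma fin_dim_gens: "L.fin_dim_subspace gens"
  unfolding L.fin_dim_subspace_def gens_def
  using finite_vimageI[OF finite_corner_gens inj] by auto

lemma corner_gens_in_image: "corner_gens \<subseteq> \<phi> ` gens"
proof
  fix r assume r: "r \<in> corner_gens"
  then obtain p where "\<phi> p = r" using derived_in_image corner_gens_subset by blast
  then show "r \<in> \<phi> ` gens" using r unfolding gens_def by (auto intro!: imageI L.span_base)
qed

lemma image_gens: "\<phi> ` gens \<subseteq> span corner_gens"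
  unfolding gens_def phi.span_image[symmetric] by (rule span_mono) auto

text \<open>To split off the last factor, insert \<open>1 = (\<Sum>c<4. E c m * E m c)\<close> in front of it, where \<open>m\<close>
  is different from both \<open>l\<close> and \<open>k\<close>. Each summand is then a product of two off-diagonal corners
  along the path \<open>l, m, k\<close> with distinct ends, and thus their commutator.\<close>

lemma corner_prod_in_lie_power:
  assumes "set gs \<subseteq> G" "gs \<noteq> []" "l < 4" "a < 4" "b < 4" "k < 4" "l \<noteq> k"
  shows "E l a * prod_list gs * E b k \<in> \<phi> ` L.lie_power gens (length gs)"
  using assms
proof (induction gs arbitrary: a b l k rule: rev_induct)
  case (snoc g hs)
  have sub: "subspace (\<phi> ` L.lie_power gens n)" for n
    by (rule phi.subspace_image) (simp add: L.lie_power_def)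
  have 1: "E l a * g * E b k \<in> \<phi> ` L.lie_power gens 1"
    if "l < 4" "a < 4" "b < 4" "k < 4" "l \<noteq> k" for l a b k
  proof -
    have "E l a * g * E b k \<in> corner_gens" 
      unfolding corner_gens_def using that snoc.prems(1) by fastforce
    then show ?thesis using corner_gens_in_image L.subset_lie_power_1[of gens] by blast
  qed
  show ?case
  proof (cases "hs = []")
    case True
    then show ?thesis using 1 snoc.prems by simp
  next
    case False
    obtain m where m: "m < 4" "m \<noteq> l" "m \<noteq> k" using ex_index[of l k k] by auto
    have hsR: "prod_list hs \<in> R" if "set hs \<subseteq> G" for hs
      using that by (induction hs) (use G in \<open>auto intro: R_mult one_R\<close>)
    have t: "E l a * (prod_list hs * E c c * g) * E b k \<in> \<phi> ` L.lie_power gens (length (hs @ [g]))"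
      if c: "c < 4" for c
    proof -
      let ?u = "E l a * prod_list hs * E c m" and ?v = "E m c * g * E b k"
      have "?u \<in> \<phi> ` L.lie_power gens (length hs)"
        using snoc.prems False m c by (intro snoc.IH) auto
      then obtain p where p: "p \<in> L.lie_power gens (length hs)" "\<phi> p = ?u" by force
      have "?v \<in> \<phi> ` L.lie_power gens 1" using snoc.prems m c by (intro 1) auto
      then obtain q where q: "q \<in> L.lie_power gens 1" "\<phi> q = ?v" by force
      have "corner l m ?u" "corner m k ?v"
        using snoc.prems m c hsR G by (auto intro!: cornerI)
      then have "\<phi> (br p q) = ?u * ?v"
        using commutator_path[of l m ?u m k ?v] snoc.prems(7) by (simp add: br p q)
      also have "\<dots> = E l a * prod_list hs * (E c m * E m c) * g * E b k" by (simp only: mult.assoc)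
      also have "\<dots> = E l a * (prod_list hs * E c c * g) * E b k"
        using m c by (simp add: E_mult mult.assoc)
      finally have *: "\<phi> (br p q) = E l a * (prod_list hs * E c c * g) * E b k" .
      have "br p q \<in> L.lie_power gens (length (hs @ [g]))"
        using L.lie_power_bracket[OF p(1) q(1)] by simp
      then show ?thesis unfolding *[symmetric] by (rule imageI)
    qed
    have "E l a * prod_list (hs @ [g]) * E b k = E l a * (prod_list hs * (\<Sum>c<4. E c c) * g) * E b k"
      by (simp add: E_sum)
    also have "\<dots> = (\<Sum>c<4. E l a * (prod_list hs * E c c * g) * E b k)"
      by (simp only: sum_distrib_left sum_distrib_right)
    also have "\<dots> \<in> \<phi> ` L.lie_power gens (length (hs @ [g]))"
      by (rule subspace_sum[OF sub]) (use t in auto)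
    finally show ?thesis .
  qed
qed simp

lemma generates_gens: "L.generates gens"
proof -
  have "H = UNIV" if H: "L.subalgebra H" "gens \<subseteq> H" for H
  proof -
    have subH: "L.subspace H" and brH: "\<And>p q. p \<in> H \<Longrightarrow> q \<in> H \<Longrightarrow> br p q \<in> H"
      using H(1) by (auto simp: L.subalgebra_def)
    note S = phi.subspace_image[OF subH]
    have corner: "r \<in> \<phi> ` H" if r: "corner i j r" and ij: "i \<noteq> j" for i j r
    proof -
      have ij4: "i < 4" "j < 4" "E i i * r * E j j = r" using r by (auto simp: corner_def)
      have "r \<in> span {prod_list gs |gs. set gs \<subseteq> G}" using R_gen r by (auto simp: corner_def)
      then have "E i i * r * E j j \<in> \<phi> ` H"
      proof (induction rule: span_induct_alt)
        case base
        show ?case using subspace_0[OF S] by simp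
      next
        case (step c r y)
        then obtain gs where gs: "r = prod_list gs" "set gs \<subseteq> G" by auto
        have "E i i * r * E j j \<in> \<phi> ` H"
        proof (cases "gs = []")
          case True
          then show ?thesis using gs(1) ij ij4 subspace_0[OF S] by (simp add: E_mult)
        next
          case False
          have "L.lie_power gens (length gs) \<subseteq> H" by (rule L.lie_power_subset_subalgebra[OF H])
          then show ?thesis
            using corner_prod_in_lie_power[OF gs(2) False, of i i j j] ij ij4 gs(1) by auto
        qed
        then show ?case using step(2)
          by (simp add: distrib_left distrib_right scale_mult_left scale_mult_right
              subspace_add[OF S] subspace_scale[OF S])
      qed
      then show ?thesis by (simp only: ij4)
    qed
    have "derived R \<subseteq> \<phi> ` H"
    proof (rule derived_subset_of_corners[OF S corner])
      fix i j r k l s assume "corner i j r" "i \<noteq> j" "corner k l s" "k \<noteq> (l::nat)"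
      then obtain p q where "r = \<phi> p" "p \<in> H" "s = \<phi> q" "q \<in> H" using corner by (metis imageE)
      then show "commutator r s \<in> \<phi> ` H" using brH by (simp flip: br)
    qed
    then have "\<phi> ` UNIV \<subseteq> \<phi> ` H" by (simp only: range)
    then show ?thesis using inj by (simp add: inj_image_subset_iff top.extremum_unique)
  qed
  then show ?thesis unfolding L.generates_def by (simp add: hull_def)
qed

end

end

section \<open>Growth in terms of factor complexity\<close>

context derived_model
begin

lemma dim_image: "L.dim U = dim (\<phi> ` U)"
proof -
  obtain C where C: "C \<subseteq> U" "L.independent C" "U \<subseteq> L.span C" "card C = L.dim U"
    by (rule L.basis_exists)
  have "independent (\<phi> ` C)"
    by (rule phi.independent_injective_image[OF C(2)]) (use inj in \<open>auto simp: inj_on_def\<close>)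
  moreover have "span (\<phi> ` C) = span (\<phi> ` U)"
  proof
    show "span (\<phi> ` C) \<subseteq> span (\<phi> ` U)" using C(1) by (intro span_mono) auto
    have "\<phi> ` U \<subseteq> span (\<phi> ` C)" unfolding phi.span_image using C(3) by (rule image_mono)
    then show "span (\<phi> ` U) \<subseteq> span (\<phi> ` C)" by (rule span_minimal) (rule subspace_span)
  qed
  ultimately have "dim (\<phi> ` U) = card (\<phi> ` C)" by (intro dim_eq_card)
  also have "\<dots> = card C" by (rule card_image) (use inj in \<open>auto simp: inj_on_def\<close>)
  finally show ?thesis using C(4) by simp
qed

lemma finite_span_of_image:
  assumes "\<phi> ` U \<subseteq> span T" "finite T"
  shows "\<exists>C. finite C \<and> U \<subseteq> L.span C"
proof -
  obtain C where C: "C \<subseteq> U" "L.independent C" "U \<subseteq> L.span C" "card C = L.dim U"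
    by (rule L.basis_exists)
  have "independent (\<phi> ` C)"
    by (rule phi.independent_injective_image[OF C(2)]) (use inj in \<open>auto simp: inj_on_def\<close>)
  moreover have "\<phi> ` C \<subseteq> span T" using C(1) assms(1) by auto
  ultimately have "finite (\<phi> ` C)" using independent_span_bound[OF assms(2)] by blast
  then have "finite C" by (rule finite_imageD) (use inj in \<open>auto simp: inj_on_def\<close>)
  then show ?thesis using C(3) by blast
qed

lemma growth_eq_dim_image: "L.growth V n = dim (\<phi> ` L.filt V n)"
  unfolding L.growth_def dim_image[symmetric] L.filt_def by simp

end

lemma window_Suc: "window x i (Suc n) = x i # window x (i + 1) n"
  unfolding window_def
  by (simp add: upt_conv_Cons map_Suc_upt[symmetric] o_def ac_simps
      del: upt_Suc)

lemma length_window [simp]: "length (window x i n) = n"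
  by (simp add: window_def)

lemma window_eq_iff: "window x i n = window x j n \<longleftrightarrow> (\<forall>m<n. x (i + int m) = x (j + int m))"
  by (auto simp: window_def)

definition indicator :: "(int \<Rightarrow> nat) \<Rightarrow> nat list \<Rightarrow> int \<Rightarrow> 'a::field"
  where "indicator x u i = (if window x i (length u) = u then 1 else 0)"

context recurrent_word
begin

lemma finite_factors: "finite (factors x n)"
proof (rule finite_subset)
  show "factors x n \<subseteq> {u. set u \<subseteq> {..<Q} \<and> length u = n}"
    using bounded by (auto simp: factors_def window_def)
  show "finite {u. set u \<subseteq> {..<Q} \<and> length u = n}" by (rule finite_lists_length_eq) simp
qed

text \<open>The value of \<open>g\<close> at \<open>i\<close> is determined by the factor of length \<open>2 * n + 1\<close> around \<open>i\<close>, which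
  starts at \<open>i - int n\<close>.\<close>

lemma local_decomposition:
  assumes "locally_determined n g"
  shows "\<exists>c. \<forall>k. weighted_shift g k = (\<Sum>u\<in>factors x (2 * n + 1).
           scale_endo (c u) (weighted_shift (\<lambda>i. indicator x u (i - int n)) k))"
proof -
  define p where "p u = (SOME i. window x i (2 * n + 1) = u)" for u
  have p: "window x (p u) (2 * n + 1) = u" if "u \<in> factors x (2 * n + 1)" for u
    unfolding p_def by (rule someI_ex) (use that in \<open>auto simp: factors_def\<close>)
  have len: "length u = 2 * n + 1" if "u \<in> factors x (2 * n + 1)" for u
    using that by (auto simp: factors_def)
  define c where "c u = g (p u + int n)" for u
  have "g i = (\<Sum>u\<in>factors x (2 * n + 1). c u * indicator x u (i - int n))" for i
  proof -
    define w where "w = window x (i - int n) (2 * n + 1)"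
    have w: "w \<in> factors x (2 * n + 1)" by (simp add: w_def factors_def)
    have "(\<Sum>u\<in>factors x (2 * n + 1). c u * indicator x u (i - int n)) =
      (\<Sum>u\<in>factors x (2 * n + 1). if u = w then c u else 0)"
      using len by (intro sum.cong) (auto simp: indicator_def w_def)
    also have "\<dots> = c w" using w finite_factors by simp
    also have "\<dots> = g i"
    proof -
      have eq: "x (p w + int m) = x (i - int n + int m)" if "m < 2 * n + 1" for m
        using p[OF w] that unfolding w_def window_eq_iff by blast
      have "agree x n (p w + int n) i"
        unfolding agree_def
      proof (intro allI impI)
        fix m assume "\<bar>m\<bar> \<le> int n"
        then have "0 \<le> int n + m" "nat (int n + m) < 2 * n + 1" by linarith+
        then show "x (p w + int n + m) = x (i + m)"
          using eq[of "nat (int n + m)"] by (simp add: algebra_simps)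
      qed
      then show ?thesis using assms by (simp add: locally_determined_def c_def)
    qed
    finally show ?thesis by simp
  qed
  then have g: "g = (\<lambda>i. \<Sum>u\<in>factors x (2 * n + 1). c u * indicator x u (i - int n))" by blast
  have "weighted_shift g k = (\<Sum>u\<in>factors x (2 * n + 1).
           scale_endo (c u) (weighted_shift (\<lambda>i. indicator x u (i - int n)) k))" for k
    using arg_cong[OF g, of "\<lambda>g. weighted_shift g k"]
    by (simp only: weighted_shift_scale weighted_shift_sum)
  then show ?thesis by blast
qed

lemma band_finite_span:
  "\<exists>S. finite S \<and> card S \<le> (2 * n + 1) * complexity x (2 * n + 1) \<and>
     (band n :: 'a::field endo set) \<subseteq> endo.span S"
proof -
  define S :: "'a endo set" where "S = (\<lambda>(u, k). weighted_shift (\<lambda>i. indicator x u (i - int n)) k)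
      ` (factors x (2 * n + 1) \<times> {- int n..int n})"
  have fin: "finite (factors x (2 * n + 1) \<times> {- int n..int n})" using finite_factors by auto
  have "card S \<le> card (factors x (2 * n + 1) \<times> {- int n..int n})"
    unfolding S_def by (rule card_image_le[OF fin])
  also have "\<dots> = (2 * n + 1) * complexity x (2 * n + 1)"
    by (simp add: complexity_def card_cartesian_product nat_add_distrib nat_mult_distrib)
  finally have "card S \<le> (2 * n + 1) * complexity x (2 * n + 1)" .
  moreover have "band n \<subseteq> endo.span S"
    unfolding band_def
  proof (rule endo.span_minimal[OF _ endo.subspace_span], safe)
    fix g :: "int \<Rightarrow> 'a" and k assume k: "\<bar>k\<bar> \<le> int n" and g: "locally_determined n g"
    obtain c where c: "weighted_shift g k = (\<Sum>u\<in>factors x (2 * n + 1).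
           scale_endo (c u) (weighted_shift (\<lambda>i. indicator x u (i - int n)) k))"
      using local_decomposition[OF g] by blast
    show "weighted_shift g k \<in> endo.span S"
      unfolding c S_def using k
      by (intro endo.span_sum endo.span_scale endo.span_base) force
  qed
  ultimately show ?thesis using fin S_def by blast
qed

text \<open>In row \<open>i\<close> only the operator that belongs to the factor occurring at \<open>i\<close> has a nonzero
  entry. Applying a linear relation to the constant function \<open>1\<close> isolates its coefficient.\<close>

lemma independent_factor_shifts:
  fixes m :: "nat list \<Rightarrow> int" and n :: nat
  defines "B \<equiv> (\<lambda>u. weighted_shift (indicator x u :: int \<Rightarrow> 'a::field) (m u)) ` factors x n"
  shows "endo.independent B" and "card B = complexity x n"
proof -
  define rowsum :: "'a endo \<Rightarrow> int \<Rightarrow> 'a" where "rowsum z i = endo_apply z (\<lambda>_. 1) i" for z i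
  have rs: "rowsum (S + T) i = rowsum S i + rowsum T i" "rowsum 0 i = 0"
    "rowsum (scale_endo c T) i = c * rowsum T i" "rowsum (weighted_shift g k) i = g i"
        for S T i c g k
    unfolding rowsum_def by (transfer; simp)+
  have rs_sum: "rowsum (\<Sum>v\<in>A. f v) i = (\<Sum>v\<in>A. rowsum (f v) i)"
      for A and f :: "'a endo \<Rightarrow> 'a endo" and i
    by (induction A rule: infinite_finite_induct) (simp_all add: rs)
  let ?F = "\<lambda>u. weighted_shift (indicator x u :: int \<Rightarrow> 'a) (m u)"
  have ind_eq: "indicator x u i = (if u = window x i n then 1 else 0 :: 'a)" if "u \<in> factors x n"
      for u i
    using that by (auto simp: indicator_def factors_def)
  have inj: "inj_on ?F (factors x n)"
  proof (rule inj_onI)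
    fix u v assume uv: "u \<in> factors x n" "v \<in> factors x n" "?F u = ?F v"
    obtain i where i: "u = window x i n" using uv(1) by (auto simp: factors_def)
    have "indicator x u i = (indicator x v i :: 'a)" using arg_cong[OF uv(3), of "\<lambda>z. rowsum z i"]
        by (simp add: rs)
    then show "u = v" using ind_eq[OF uv(1), of i] ind_eq[OF uv(2), of i] i
        by (auto split: if_splits)
  qed
  then show "card B = complexity x n" by (simp add: B_def complexity_def card_image)
  have finB: "finite B" unfolding B_def using finite_factors by simp
  show "endo.independent B"
  proof (rule endo.independent_if_scalars_zero[OF finB])
    fix f z assume s: "(\<Sum>z\<in>B. scale_endo (f z) z) = 0" and "z \<in> B"
    then obtain u where u: "u \<in> factors x n" "z = ?F u" by (auto simp: B_def)
    obtain i where i: "u = window x i n" using u(1) by (auto simp: factors_def)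
    have "0 = rowsum (\<Sum>z\<in>B. scale_endo (f z) z) i" by (simp add: s rs)
    also have "\<dots> = (\<Sum>z\<in>B. f z * rowsum z i)" by (simp add: rs_sum rs)
    also have "\<dots> = (\<Sum>v\<in>factors x n. f (?F v) * indicator x v i)"
      unfolding B_def by (subst sum.reindex[OF inj]) (simp add: rs)
    also have "\<dots> = (\<Sum>v\<in>factors x n. if v = u then f (?F v) else 0)"
      by (rule sum.cong) (auto simp: ind_eq i)
    also have "\<dots> = f z" using u finite_factors by simp
    finally show "f z = 0" by simp
  qed
qed

definition letter_gens :: "'a::field endo set"
  where "letter_gens = {weighted_shift (\<lambda>_. 1) 1, weighted_shift (\<lambda>_. 1) (- 1)} \<union>
    (\<lambda>c. weighted_shift (\<lambda>t. if x t = c then 1 else 0) 0) ` {..<Q}"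

text \<open>The operators that test a letter and step to the right, in alternation. Their product tests
  whether the word \<open>u\<close> occurs, and moves past it.\<close>

definition factor_path :: "nat list \<Rightarrow> 'a::field endo list"
  where "factor_path u = concat (map (\<lambda>c. [weighted_shift (\<lambda>t. if x t = c then 1 else 0) 0,
            weighted_shift (\<lambda>_. 1) 1]) u)"

lemma finite_letter_gens: "finite letter_gens"
  by (simp add: letter_gens_def)

lemma letter_gens_band: "letter_gens \<subseteq> band 1"
proof -
  have "locally_determined 1 (\<lambda>t. if x (t + 0) = c then 1 else 0)" for c
    by (rule local_mono[OF local_letter]) simp
  then show ?thesis by (auto simp: letter_gens_def intro!: weighted_shift_in_band local_const)
qed

lemma prod_factor_path:
  "(prod_list (factor_path u) :: 'a::field endo) = weighted_shift (indicator x u) (int (length u))"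
proof (induction u)
  case Nil
  then show ?case by (simp add: factor_path_def indicator_def window_def weighted_shift_one)
next
  case (Cons c u)
  have "(prod_list (factor_path (c # u)) :: 'a endo) = weighted_shift (\<lambda>t. if x t
      = c then 1 else 0) 0 *
      (weighted_shift (\<lambda>_. 1) 1 * weighted_shift (indicator x u) (int (length u)))"
    using Cons by (simp add: factor_path_def mult.assoc)
  also have "\<dots> = weighted_shift (\<lambda>i. (if x i = c then 1 else 0) * indicator x u (i + 1)) (1
      + int (length u))"
    by (simp add: weighted_shift_mult)
  also have "(\<lambda>i. (if x i = c then 1 else 0) * indicator x u (i + 1)) = indicator x (c # u)"
    by (auto simp: indicator_def window_Suc fun_eq_iff)
  finally show ?case by simp
qed

lemma factor_path_gens: "u \<in> factors x n \<Longrightarrow> set (factor_path u) \<subseteq> letter_gens"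
  using bounded by (auto simp: factors_def window_def factor_path_def letter_gens_def)

lemma length_factor_path: "length (factor_path u) = 2 * length u"
  by (induction u) (simp_all add: factor_path_def)

lemma pure_shift_prod:
  "\<exists>gs. set gs \<subseteq> letter_gens \<and> prod_list gs = weighted_shift (\<lambda>_. 1::'a::field) k"
proof -
  have 1: "prod_list (replicate n (weighted_shift (\<lambda>_. 1::'a) s))
      = weighted_shift (\<lambda>_. 1) (int n * s)" for n s
    by (induction n) (simp_all add: weighted_shift_one weighted_shift_mult algebra_simps)
  show ?thesis
  proof (cases "k \<ge> 0")
    case True
    then show ?thesis using 1[of "nat k" 1]
      by (intro exI[of _ "replicate (nat k) (weighted_shift (\<lambda>_. 1) 1)"])
        (auto simp: letter_gens_def set_replicate_conv_if)
  next
    case False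
    then show ?thesis using 1[of "nat (- k)" "- 1"]
      by (intro exI[of _ "replicate (nat (- k)) (weighted_shift (\<lambda>_. 1) (- 1))"])
        (auto simp: letter_gens_def set_replicate_conv_if)
  qed
qed

lemma word_algebra_generated:
  "(word_algebra :: 'a::field endo set) \<subseteq> endo.span {prod_list gs |gs. set gs \<subseteq> letter_gens}"
proof -
  let ?P = "{prod_list gs |gs. set gs \<subseteq> letter_gens} :: 'a endo set"
  have mult: "a * b \<in> ?P" if "a \<in> ?P" "b \<in> ?P" for a b
  proof -
    obtain gs hs where "a = prod_list gs" "set gs \<subseteq> letter_gens" "b = prod_list hs"
        "set hs \<subseteq> letter_gens"
      using \<open>a \<in> ?P\<close> \<open>b \<in> ?P\<close> by blast
    then have "a * b = prod_list (gs @ hs)" "set (gs @ hs) \<subseteq> letter_gens" by auto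
    then show ?thesis by blast
  qed
  have shift: "weighted_shift (\<lambda>_. 1) k \<in> ?P" for k
    using pure_shift_prod[of k, where ?'a = 'a] by (smt (verit) mem_Collect_eq)
  have "band n \<subseteq> endo.span ?P" for n
    unfolding band_def
  proof (rule endo.span_minimal[OF _ endo.subspace_span], safe)
    fix g :: "int \<Rightarrow> 'a" and k assume g: "locally_determined n g"
    obtain c where c: "weighted_shift g k = (\<Sum>u\<in>factors x (2 * n + 1).
           scale_endo (c u) (weighted_shift (\<lambda>i. indicator x u (i - int n)) k))"
      using local_decomposition[OF g] by blast
    have "weighted_shift (\<lambda>i. indicator x u (i - int n)) k \<in> ?P" if u: "u \<in> factors x (2 * n + 1)"
        for u
    proof -
      have "weighted_shift (\<lambda>_. 1) (- int n) * prod_list (factor_path u)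
          * weighted_shift (\<lambda>_. 1) (k + int n - int (length u)) \<in> ?P"
        using factor_path_gens[OF u] by (intro mult shift) blast
      then show ?thesis by (simp add: prod_factor_path weighted_shift_mult)
    qed
    then show "weighted_shift g k \<in> endo.span ?P"
      unfolding c by (intro endo.span_sum endo.span_scale endo.span_base)
  qed
  then show ?thesis by (auto simp: word_algebra_def)
qed

text \<open>The residue of the position modulo 4 is known at an occurrence of \<open>u\<close>, so the two matrix
  units impose no condition beyond the occurrence of \<open>u\<close> and only adjust the shift.\<close>

lemma corner_factor_path:
  assumes u: "u \<in> factors x n" and n: "1 \<le> n"
  defines "l \<equiv> hd u mod 4"
  defines "b \<equiv> (l + n) mod 4"
  shows "matrix_unit l l * prod_list (factor_path u) * matrix_unit b k
    = weighted_shift (indicator x u :: int \<Rightarrow> 'a::field) (int n + int k - int b)"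
proof -
  have len: "length u = n" using u by (auto simp: factors_def)
  have "(if i mod 4 = int l then 1 else 0) * indicator x u i *
      (if (i + int n) mod 4 = int b then 1 else 0) = (indicator x u i :: 'a)" for i
  proof (cases "window x i n = u")
    case True
    then have "hd u = x i" using n by (cases n) (auto simp: window_Suc)
    then have "int l = i mod 4" using mod4[of i] by (simp add: l_def zmod_int)
    moreover from this have "int b = (i + int n) mod 4"
      by (simp add: b_def zmod_int mod_add_left_eq)
    ultimately show ?thesis by simp
  next
    case False
    then show ?thesis using len by (simp add: indicator_def)
  qed
  then show ?thesis
    by (simp only: matrix_unit_def prod_factor_path weighted_shift_mult len diff_self add_0_left
        add_0_right add_diff_eq)
qed

text \<open>The letters, shifts and matrix units give generators of \<open>[R, R]\<close> inside \<open>band 7\<close>, so Lie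
  products of length at most \<open>n\<close> lie in \<open>band (7 * n)\<close>. This gives the upper bound; the lower
  bound comes from the \<open>2 * n\<close> factors of \<open>factor_path u\<close> for each factor \<open>u\<close> of length \<open>n\<close>.\<close>

theorem word_lie_algebra:
  assumes two: "(2::'a::field) \<noteq> 0" and unbounded: "\<And>n. \<exists>m\<ge>1. n < complexity x m"
  shows "\<exists>br :: 'a poly \<Rightarrow> 'a poly \<Rightarrow> 'a poly.
           lie_algebra smult br \<and> lie_algebra.finitely_generated smult br \<and>
           lie_algebra.simple smult br \<and>
           (\<exists>h. (\<forall>n\<ge>1. complexity x n \<le> h (2 * n)) \<and>
              (\<forall>n. h n \<le> (14 * n + 1) * complexity x (14 * n + 1)) \<and> mono h \<and>
           (\<forall>V. lie_algebra.fin_dim_subspace smult V \<and> lie_algebra.generates smult br V \<longrightarrow>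
                (\<lambda>n. real (lie_algebra.growth smult br V n)) \<sim>\<^sub>g (\<lambda>n. real (h n))))"
proof -
  have corner_path:
      "corner (hd u mod 4) ((hd u mod 4 + 1) mod 4) (matrix_unit (hd u mod 4) (hd u mod 4)
      * prod_list (factor_path u) * matrix_unit ((hd u mod 4 + n) mod 4) ((hd u mod 4 + 1) mod 4)
          :: 'a endo)"
    if u: "u \<in> factors x n" for u n
  proof (rule cornerI)
    have "g \<in> word_algebra" if "g \<in> letter_gens" for g :: "'a endo"
      using that letter_gens_band band_subset by blast
    then have "set gs \<subseteq> letter_gens \<Longrightarrow> prod_list gs \<in> word_algebra" for gs :: "'a endo list"
      by (induction gs) (auto intro: R_mult one_R)
    then show "prod_list (factor_path u) \<in> (word_algebra :: 'a endo set)"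
      using factor_path_gens[OF u] by blast
  qed auto
  \<comment> \<open>Any column other than the row \<open>hd u mod 4\<close> makes the corner off-diagonal.\<close>
  define m where "m n u = int n + int ((hd u mod 4 + 1) mod 4) - int ((hd u mod 4 + n) mod 4)"
    for n and u :: "nat list"
  define B :: "nat \<Rightarrow> 'a endo set"
    where "B n = (\<lambda>u. weighted_shift (indicator x u) (m n u)) ` factors x n" for n
  note B_indep = independent_factor_shifts[where ?'a = 'a and m = "m n" and n = n
      for n, folded B_def]
  have neq: "(a::nat) mod 4 \<noteq> (a mod 4 + 1) mod 4" for a by presburger
  have B_derived: "B n \<subseteq> endo.derived word_algebra" if n: "1 \<le> n" for n
  proof
    fix z assume "z \<in> B n"
    then obtain u where u: "u \<in> factors x n" "z = weighted_shift (indicator x u) (m n u)"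
        by (auto simp: B_def)
    show "z \<in> endo.derived word_algebra"
      unfolding u(2) m_def corner_factor_path[OF u(1) n, symmetric]
      by (rule corner_in_derived[OF corner_path[OF u(1)] neq])
  qed
  have derived_bands: "(endo.derived word_algebra :: 'a endo set) \<subseteq> word_algebra"
    by (rule endo.derived_subset[OF subalg_word_algebra])
  obtain S :: "nat \<Rightarrow> 'a endo set" where S: "\<And>n. finite (S n)"
    "\<And>n. card (S n) \<le> (2 * n + 1) * complexity x (2 * n + 1)" "\<And>n. band n \<subseteq> endo.span (S n)"
    using band_finite_span[where ?'a = 'a] by metis
  have "\<exists>\<phi> :: 'a poly \<Rightarrow> 'a endo. module_hom smult scale_endo \<phi> \<and> inj \<phi> \<and> range \<phi>
      = endo.derived word_algebra"
  proof (rule endo.poly_isomorphism[OF endo.subspace_derived _ S(1)])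
    show "(endo.derived word_algebra :: 'a endo set) \<subseteq> (\<Union>n. endo.span (S n))"
      using derived_bands S(3) unfolding word_algebra_def by blast
    fix n
    obtain k where k: "1 \<le> k" "n < complexity x k" using unbounded by blast
    then show "\<exists>B\<subseteq>(endo.derived word_algebra :: 'a endo set). endo.independent B \<and> n < card B"
      using B_derived B_indep[of k] by (intro exI[of _ "B k"]) auto
  qed
  then obtain \<phi> :: "'a poly \<Rightarrow> 'a endo"
    where \<phi>: "module_hom smult scale_endo \<phi>" "inj \<phi>" "range \<phi> = endo.derived word_algebra" by blast
  define br where "br = (\<lambda>p q. inv \<phi> (commutator (\<phi> p) (\<phi> q)))"
  note model = endo.derived_model_lie_algebra[OF subalg_word_algebra vector_space_smult \<phi> br_def]
  interpret M: derived_model scale_endo word_algebra matrix_unit smult br \<phi>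
    unfolding derived_model_def derived_model_axioms_def
    using model \<phi> matrix_algebra_axioms by auto
  note gens = finite_letter_gens subset_trans[OF letter_gens_band band_subset]
      word_algebra_generated
  define V where "V = M.gens letter_gens"
  have V: "M.L.fin_dim_subspace V" "M.L.generates V"
    unfolding V_def by (rule M.fin_dim_gens[OF gens] M.generates_gens[OF gens])+
  have "\<phi> ` V \<subseteq> endo.span (M.corner_gens letter_gens)"
    unfolding V_def by (rule M.image_gens[OF gens])
  also have "\<dots> \<subseteq> band 7"
  proof (rule endo.span_minimal[OF _ subspace_band], rule subsetI)
    fix z assume "z \<in> M.corner_gens letter_gens"
    then obtain l a g b k where z: "z = matrix_unit l a * g * matrix_unit b k" "l < 4" "a < 4"
        "b < 4" "k < 4"
      "g \<in> letter_gens" unfolding M.corner_gens_def[OF gens] by blast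
    \<comment> \<open>The two matrix units contribute 3 each, the generator between them 1.\<close>
    have "matrix_unit l a * g * matrix_unit b k \<in> band (3 + 1 + 3)"
      using z letter_gens_band by (intro band_mult unit_in_band) auto
    then show "z \<in> band 7" by (simp add: z(1))
  qed
  finally have V7: "\<phi> ` V \<subseteq> band 7" .
  have prod7: "\<phi> p \<in> band (7 * i)" if "M.L.lie_product V i p" for i p
    using that
  proof (induction rule: M.L.lie_product.induct)
    case (step i p j q)
    then show ?case using band_commutator[of "\<phi> p" "7 * i" "\<phi> q" "7 * j"]
      by (simp add: M.br algebra_simps)
  qed (use V7 in auto)
  have filt7: "\<phi> ` M.L.filt V n \<subseteq> band (7 * n)" for n
  proof -
    have "\<phi> ` M.L.lie_power V i \<subseteq> band (7 * n)" if "i \<le> n" for i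
    proof -
      have "(band (7 * i) :: 'a endo set) \<subseteq> band (7 * n)" using that by (intro band_mono) simp
      then show ?thesis
        unfolding M.L.lie_power_def M.phi.span_image[symmetric]
        using prod7 by (intro endo.span_minimal subspace_band) blast
    qed
    then show ?thesis
      unfolding M.L.filt_def M.phi.span_image[symmetric]
      by (intro endo.span_minimal subspace_band) (simp add: image_UN UN_subset_iff)
  qed
  have fin: "\<exists>T. finite T \<and> M.L.filt V n \<subseteq> M.L.span T" for n
    using M.finite_span_of_image[OF subset_trans[OF filt7 S(3)] S(1)] .
  define h where "h n = M.L.growth V n" for n
  have upper: "h n \<le> (14 * n + 1) * complexity x (14 * n + 1)" for n
  proof -
    have "h n \<le> card (S (7 * n))"
      unfolding h_def M.growth_eq_dim_image
      by (rule endo.dim_le_card[OF subset_trans[OF filt7 S(3)] S(1)])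
    also have "\<dots> \<le> (14 * n + 1) * complexity x (14 * n + 1)" using S(2)[of "7 * n"] by simp
    finally show ?thesis .
  qed
  have lower: "complexity x n \<le> h (2 * n)" if n: "1 \<le> n" for n
  proof -
    have "B n \<subseteq> \<phi> ` M.L.filt V (2 * n)"
    proof
      fix z assume "z \<in> B n"
      then obtain u where u: "u \<in> factors x n" "z = weighted_shift (indicator x u) (m n u)"
          by (auto simp: B_def)
      have len: "length (factor_path u :: 'a endo list) = 2 * n" using u(1)
          by (auto simp: length_factor_path factors_def)
      have "(factor_path u :: 'a endo list) \<noteq> []" using len n by auto
      then have "z \<in> \<phi> ` M.L.lie_power V (2 * n)"
        using M.corner_prod_in_lie_power[OF gens factor_path_gens[OF u(1)], of "hd u mod 4"
            "hd u mod 4"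
            "(hd u mod 4 + n) mod 4" "(hd u mod 4 + 1) mod 4"] neq[of "hd u"]
          corner_factor_path[OF u(1) n, where ?'a = 'a] len
        by (simp add: u(2) m_def V_def)
      then show "z \<in> \<phi> ` M.L.filt V (2 * n)"
        using M.L.lie_power_subset_filt[of "2 * n" "2 * n" V] n by auto
    qed
    then have "B n \<subseteq> endo.span (\<phi> ` M.L.filt V (2 * n))"
      using endo.span_superset by (rule subset_trans)
    from endo.card_le_dim_of_independent[OF B_indep(1) this subset_trans[OF filt7 S(3)] S(1)]
    show ?thesis by (simp add: B_indep(2) h_def M.growth_eq_dim_image)
  qed
  have "mono h"
  proof (rule monoI)
    fix i j :: nat assume "i \<le> j"
    then have "\<phi> ` M.L.filt V i \<subseteq> endo.span (\<phi> ` M.L.filt V j)"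
      using M.L.filt_mono endo.span_superset by blast
    from endo.dim_mono_finite_span[OF this subset_trans[OF filt7 S(3)] S(1)]
    show "h i \<le> h j" by (simp add: h_def M.growth_eq_dim_image)
  qed
  moreover have "(\<lambda>n. real (M.L.growth W n)) \<sim>\<^sub>g (\<lambda>n. real (h n))"
    if "M.L.fin_dim_subspace W" "M.L.generates W" for W
    unfolding h_def by (rule M.L.growth_equiv_generating[OF that V fin])
  moreover have "M.L.finitely_generated"
  proof -
    obtain C where C: "finite C" "V = M.L.span C" using V(1)
        by (auto simp: M.L.fin_dim_subspace_def)
    have "V \<subseteq> H" if "M.L.subalgebra H" "C \<subseteq> H" for H
      unfolding C(2) using that by (intro M.L.span_minimal) (auto simp: M.L.subalgebra_def)
    then have "M.L.subalgebra hull V \<subseteq> M.L.subalgebra hull C" unfolding hull_def by blast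
    then have "M.L.generates C" using V(2) unfolding M.L.generates_def by blast
    then show ?thesis using C(1) by (auto simp: M.L.finitely_generated_def)
  qed
  moreover have "M.L.simple"
    by (rule M.simple_derived_model[OF simple_word_algebra two derived_centre_trivial[OF two]])
  ultimately show ?thesis
    using M.L.lie_algebra_axioms lower upper by (intro exI[of _ br]) blast
qed

end

section \<open>Recurrent words of prescribed complexity\<close>

text \<open>Each word is listed infinitely often. A word that is too expensive to prescribe at one level
  is therefore considered again at higher levels, where it is affordable.\<close>

definition word_enum :: "nat \<Rightarrow> nat list"
  where "word_enum k = from_nat (fst (prod_decode k))"

lemma word_enum_often: "\<exists>k\<ge>j. word_enum k = z"
proof (intro exI conjI)
  show "j \<le> prod_encode (to_nat z, j)" by (rule le_prod_encode_2)
  show "word_enum (prod_encode (to_nat z, j)) = z" by (simp add: word_enum_def)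
qed

locale block_words =
  fixes F :: "nat \<Rightarrow> nat"
  assumes F_pos: "1 \<le> F k" and F_mono: "F k \<le> F (Suc k)" and F_submult: "F (Suc k) \<le> F k * F k"
begin

text \<open>The word listed at \<open>k\<close> is prescribed as a factor if this keeps at least a fraction \<open>2 ^ - k\<close>
  of the set \<open>A\<close>.\<close>

definition candidates :: "nat \<Rightarrow> nat list set \<Rightarrow> nat list set"
  where "candidates k A = (let Z = {w\<in>A. sublist (word_enum k) w} in
     if card A \<le> 2 ^ k * card Z then Z else A)"

text \<open>The number of selected words is the largest one for which the number of blocks of the next
  level stays within the bound \<open>F (Suc k) * 2 ^ (k + 4)\<close> of \<open>card_blocks_bounds\<close>, if there are
  that many candidates.\<close>

definition select :: "nat \<Rightarrow> nat list set \<Rightarrow> nat list set"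
  where "select k A = (SOME D. D \<subseteq> candidates k A \<and>
     card D = min (card (candidates k A)) (F (Suc k) * 2 ^ (k + 4) div card A))"

text \<open>In a block of level \<open>0\<close> each letter is congruent to its position modulo 4. The selected
  blocks stand on the left at even and on the right at odd levels. Hence every block, selected or
  not, extends to the left at even and to the right at odd levels.\<close>

fun blocks :: "nat \<Rightarrow> nat list set"
  where
    "blocks 0 = (\<lambda>s. [4 * s, 1, 2, 3]) ` {..<4 * F 0}"
  | "blocks (Suc k) = (\<lambda>(a, b). a @ b) ` (if even k then select k (blocks k)
      \<times> blocks k else blocks k \<times> select k (blocks k))"

definition selected :: "nat \<Rightarrow> nat list set"
  where "selected k = select k (blocks k)"

definition left_blocks :: "nat \<Rightarrow> nat list set"
  where "left_blocks k = (if even k then selected k else blocks k)"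

definition right_blocks :: "nat \<Rightarrow> nat list set"
  where "right_blocks k = (if even k then blocks k else selected k)"

lemma blocks_Suc: "blocks (Suc k) = (\<lambda>(a, b). a @ b) ` (left_blocks k \<times> right_blocks k)"
  by (simp add: left_blocks_def right_blocks_def selected_def)

declare blocks.simps(2) [simp del]

lemma select_spec:
  assumes "finite A"
  shows "select k A \<subseteq> candidates k A \<and>
     card (select k A) = min (card (candidates k A)) (F (Suc k) * 2 ^ (k + 4) div card A)"
proof -
  let ?n = "min (card (candidates k A)) (F (Suc k) * 2 ^ (k + 4) div card A)"
  have "?n \<le> card (candidates k A)" by simp
  from obtain_subset_with_card_n[OF this]
  obtain T where "T \<subseteq> candidates k A" "card T = ?n" by blast
  then have "T \<subseteq> candidates k A \<and> card T = ?n" ..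
  then show ?thesis unfolding select_def by (rule someI)
qed

lemma candidates_subset: "candidates k A \<subseteq> A"
  by (auto simp: candidates_def Let_def)

lemma finite_blocks: "finite (blocks k)"
proof (induction k)
  case (Suc k)
  then have "finite (selected k)" unfolding selected_def
    using select_spec[OF Suc, of k] candidates_subset[of k "blocks k"] finite_subset[OF _ Suc]
        by blast
  with Suc show ?case by (simp add: blocks_Suc left_blocks_def right_blocks_def)
qed simp

lemma selected_subset_candidates: "selected k \<subseteq> candidates k (blocks k)"
  and card_selected:
      "card (selected k) = min (card (candidates k (blocks k))) (F (Suc k) * 2 ^ (k
          + 4) div card (blocks k))"
  using select_spec[OF finite_blocks] by (simp_all add: selected_def)

lemma selected_subset: "selected k \<subseteq> blocks k"
  using selected_subset_candidates candidates_subset by blast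

lemma left_blocks_subset: "left_blocks k \<subseteq> blocks k" and right_blocks_subset:
    "right_blocks k \<subseteq> blocks k"
  using selected_subset by (auto simp: left_blocks_def right_blocks_def)

lemma blocks_SucE:
  assumes "w \<in> blocks (Suc k)"
  obtains a b where "w = a @ b" "a \<in> left_blocks k" "b \<in> right_blocks k" "a \<in> blocks k"
      "b \<in> blocks k"
proof -
  from assms obtain a b where "w = a @ b" "a \<in> left_blocks k" "b \<in> right_blocks k"
      by (auto simp: blocks_Suc)
  with left_blocks_subset right_blocks_subset show ?thesis by (intro that) auto
qed

lemma length_blocks: "w \<in> blocks k \<Longrightarrow> length w = 4 * 2 ^ k"
proof (induction k arbitrary: w)
  case (Suc k)
  from Suc.prems obtain a b where "w = a @ b" "a \<in> blocks k" "b \<in> blocks k" by (rule blocks_SucE)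
  then show ?case using Suc.IH by simp
qed auto

lemma inj_append_blocks: "inj_on (\<lambda>(a, b). a @ b) (blocks k \<times> blocks k)"
  by (rule inj_onI) (auto simp: length_blocks)

lemma card_append_blocks:
  assumes "A \<subseteq> blocks k" "B \<subseteq> blocks k"
  shows "card ((\<lambda>(a, b). a @ b) ` (A \<times> B)) = card A * card B"
proof -
  have "inj_on (\<lambda>(a, b). a @ b) (A \<times> B)"
    by (rule inj_on_subset[OF inj_append_blocks]) (use assms in auto)
  then show ?thesis by (simp add: card_image card_cartesian_product)
qed

lemma card_blocks_Suc: "card (blocks (Suc k)) = card (selected k) * card (blocks k)"
  unfolding blocks_Suc card_append_blocks[OF left_blocks_subset right_blocks_subset]
      by (simp add: left_blocks_def right_blocks_def)

lemma card_candidates: "card A \<le> 2 ^ k * card (candidates k A)"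
proof -
  have "card A \<le> 2 ^ k * card A" by simp
  then show ?thesis by (auto simp: candidates_def Let_def)
qed

text \<open>Let \<open>a\<close> be the number of blocks of level \<open>k\<close>. If all candidates are selected, then level
  \<open>k + 1\<close> has at least \<open>a\<^sup>2 / 2 ^ k\<close> blocks, and \<open>a\<^sup>2 / 2 ^ k \<ge> (F k)\<^sup>2 * 2 ^ (k + 4) \<ge> F (k + 1)
  * 2 ^ (k + 4)\<close> by submultiplicativity. Otherwise only rounding separates the number of blocks
  from the upper bound, and this costs at most a factor \<open>2\<close>.\<close>

lemma card_blocks_bounds:
    "F k * 2 ^ (k + 2) \<le> card (blocks k) \<and> card (blocks k) \<le> F k * 2 ^ (k + 3)"
proof (induction k)
  case 0
  have "card (blocks 0) = 4 * F 0" by (simp add: card_image inj_on_def)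
  then show ?case by simp
next
  case (Suc k)
  let ?a = "card (blocks k)" and ?s = "card (candidates k (blocks k))" and ?T =
      "F (Suc k) * 2 ^ (k + 4)"
  have a: "F k * 2 ^ (k + 2) \<le> ?a" "?a \<le> F k * 2 ^ (k + 3)" using Suc by auto
  have "0 < F k * 2 ^ (k + 2)" using F_pos[of k] by simp
  then have a0: "0 < ?a" using a(1) by linarith
  have "F k * 2 ^ (k + 3) \<le> F (Suc k) * 2 ^ (k + 4)" using F_mono[of k] by (intro mult_mono) auto
  then have aT: "?a \<le> ?T" using a(2) by linarith
  have card: "card (blocks (Suc k)) = min (?s * ?a) (?T div ?a * ?a)"
    unfolding card_blocks_Suc card_selected by (simp add: min_def)
  have "F (Suc k) * 2 ^ (k + 3) \<le> ?s * ?a"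
  proof -
    have "F (Suc k) * 2 ^ (k + 4) * 2 ^ k \<le> (F k * F k) * 2 ^ (k + 4) * 2 ^ k"
      using F_submult[of k] by (intro mult_right_mono) auto
    also have "\<dots> = (F k * 2 ^ (k + 2)) * (F k * 2 ^ (k + 2))" by (simp add: power_add)
    also have "\<dots> \<le> ?a * ?a" using a(1) by (intro mult_mono) auto
    also have "\<dots> \<le> (2 ^ k * ?s) * ?a" using card_candidates[of "blocks k" k]
        by (intro mult_right_mono) auto
    finally have "2 ^ k * (F (Suc k) * 2 ^ (k + 4)) \<le> 2 ^ k * (?s * ?a)" by (simp add: mult_ac)
    then have "F (Suc k) * 2 ^ (k + 4) \<le> ?s * ?a" by simp
    then show ?thesis by (simp add: power_add)
  qed
  note h1 = this
  have h2: "F (Suc k) * 2 ^ (k + 3) \<le> ?T div ?a * ?a"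
  proof -
    have "?T = ?T div ?a * ?a + ?T mod ?a" by simp
    moreover have "?T mod ?a < ?a" using a0 by simp
    moreover have "?a \<le> ?T div ?a * ?a"
      using aT a0 by (simp add: div_greater_zero_iff Suc_le_eq)
    ultimately have "?T \<le> 2 * (?T div ?a * ?a)" by linarith
    moreover have "?T = 2 * (F (Suc k) * 2 ^ (k + 3))" by (simp add: power_add)
    ultimately show ?thesis by linarith
  qed
  have h3: "?T div ?a * ?a \<le> F (Suc k) * 2 ^ (Suc k + 3)"
  proof -
    have "Suc k + 3 = k + 4" by simp
    then show ?thesis using div_times_less_eq_dividend[of ?T ?a] by (simp only:)
  qed
  have "Suc k + 2 = k + 3" by simp
  with h1 h2 h3 show ?case unfolding card by (simp only: min_le_iff_disj min.bounded_iff simp_thms)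
qed

lemma card_blocks_pos: "0 < card (blocks k)"
proof -
  have "0 < F k * 2 ^ (k + 2)" using F_pos[of k] by simp
  then show ?thesis using card_blocks_bounds[of k] by linarith
qed

lemma selected_nonempty: "selected k \<noteq> {}"
proof
  assume "selected k = {}"
  then have "card (blocks (Suc k)) = 0" by (simp add: card_blocks_Suc)
  then show False using card_blocks_pos[of "Suc k"] by simp
qed

text \<open>At each level one of the two halves of a block is arbitrary. Requiring it to contain \<open>z\<close>
  therefore does not decrease the proportion of blocks that contain \<open>z\<close>, which is at least
  \<open>1 / card (blocks j)\<close> at level \<open>j\<close>.\<close>

lemma card_containing:
  assumes "j \<le> k" "z \<in> blocks j"
  shows "card (blocks k) \<le> card (blocks j) * card {w \<in> blocks k. sublist z w}"
  using assms(1)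
proof (induction k rule: dec_induct)
  case base
  have "z \<in> {w \<in> blocks j. sublist z w}" using assms(2) by simp
  then have "0 < card {w \<in> blocks j. sublist z w}" using finite_blocks[of j] card_gt_0_iff
      by fastforce
  then show ?case by simp
next
  case (step k)
  let ?Z = "{w \<in> blocks k. sublist z w}"
  let ?P = "if even k then selected k \<times> ?Z else ?Z \<times> selected k"
  have "(\<lambda>(a, b). a @ b) ` ?P \<subseteq> {w \<in> blocks (Suc k). sublist z w}"
    by (auto simp: blocks_Suc left_blocks_def right_blocks_def sublist_appendI sublist_append
        split: if_splits)
  then have "card ((\<lambda>(a, b). a @ b) ` ?P) \<le> card {w \<in> blocks (Suc k). sublist z w}"
    using finite_blocks by (intro card_mono) auto
  moreover have "card ((\<lambda>(a, b). a @ b) ` ?P) = card (selected k) * card ?Z"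
    using card_append_blocks[of "selected k" k ?Z] card_append_blocks[of ?Z k "selected k"]
        selected_subset[of k] by auto
  ultimately have "card (selected k) * card ?Z \<le> card {w \<in> blocks (Suc k). sublist z w}" by simp
  have "card (blocks (Suc k)) = card (selected k) * card (blocks k)" by (rule card_blocks_Suc)
  also have "\<dots> \<le> card (selected k) * (card (blocks j) * card ?Z)" using step.IH
      by (rule mult_left_mono) simp
  also have "\<dots> = card (blocks j) * (card (selected k) * card ?Z)" by simp
  also have "\<dots> \<le> card (blocks j) * card {w \<in> blocks (Suc k). sublist z w}"
    using \<open>card (selected k) * card ?Z \<le> _\<close> by (rule mult_left_mono) simp
  finally show ?case .
qed

lemma eventually_contained:
  assumes z: "z \<in> blocks j"
  shows "\<exists>m. \<forall>w\<in>blocks m. sublist z w"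
proof -
  obtain k where k: "max j (card (blocks j)) \<le> k" "word_enum k = z" using word_enum_often by blast
  have "card (blocks j) \<le> k" using k(1) by simp
  also have "k \<le> 2 ^ k" by (rule less_imp_le[OF less_exp])
  finally have "card (blocks j) \<le> 2 ^ k" .
  then have "card (blocks j) * card {w \<in> blocks k. sublist z w} \<le> 2 ^ k * card {w
      \<in> blocks k. sublist z w}"
    by (rule mult_right_mono) simp
  with card_containing[OF _ z, of k] k(1)
  have "card (blocks k) \<le> 2 ^ k * card {w \<in> blocks k. sublist z w}" by linarith
  then have "candidates k (blocks k) = {w \<in> blocks k. sublist z w}"
      by (simp add: candidates_def k(2))
  then have "sublist z c" if "c \<in> selected k" for c using selected_subset_candidates[of k] that
      by auto
  then have "sublist z w" if "w \<in> blocks (Suc k)" for w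
    using that by (auto simp: blocks_Suc left_blocks_def right_blocks_def sublist_append split:
        if_splits)
  then show ?thesis by blast
qed

section \<open>Factors of blocks\<close>

lemma first_last_block:
  assumes "k < M" "w \<in> blocks M"
  shows "(\<exists>a\<in>left_blocks k. prefix a w) \<and> (\<exists>b\<in>right_blocks k. suffix b w)"
  using assms
proof (induction M arbitrary: w)
  case (Suc M)
  obtain a b where w: "w = a @ b" "a \<in> left_blocks M" "b \<in> right_blocks M" using Suc.prems(2)
      by (auto simp: blocks_Suc)
  show ?case
  proof (cases "k = M")
    case True
    then show ?thesis
      using w by (intro conjI bexI[of _ a] bexI[of _ b]) (auto simp: suffix_def)
  next
    case False
    then have "k < M" using Suc.prems(1) by simp
    moreover have "a \<in> blocks M" "b \<in> blocks M"
        using w left_blocks_subset[of M] right_blocks_subset[of M] by auto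
    ultimately obtain p q where "p \<in> left_blocks k" "prefix p a" "q \<in> right_blocks k" "suffix q b"
      using Suc.IH by blast
    then show ?thesis unfolding w(1) using prefix_prefix suffix_appendI by blast
  qed
qed simp

lemma first_last_block_le:
  assumes "k \<le> M" "w \<in> blocks M"
  shows "(\<exists>a\<in>blocks k. prefix a w) \<and> (\<exists>b\<in>blocks k. suffix b w)"
proof (cases "k = M")
  case True
  then show ?thesis using assms(2) by auto
next
  case False
  then show ?thesis
    using first_last_block[of k M w] assms left_blocks_subset[of k] right_blocks_subset[of k]
        by fastforce
qed

text \<open>Where two blocks of a higher level meet, the last block of level \<open>k\<close> in the first of them is
  a right half, and the first block of level \<open>k\<close> in the second is a left half. So left and right
  halves alternate, and one of the two kinds consists of selected blocks.\<close>

lemma short_sublist_in_pair: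
  assumes "k < M" "w \<in> blocks M" "sublist v w" "length v \<le> 4 * 2 ^ k"
  shows "\<exists>d \<in> (\<lambda>(a, b). a @ b) ` (left_blocks k \<times> right_blocks k \<union> right_blocks k
      \<times> left_blocks k). sublist v d"
  using assms
proof (induction M arbitrary: w)
  case (Suc M)
  show ?case
  proof (cases "k = M")
    case True
    then show ?thesis using Suc.prems(2,3) unfolding blocks_Suc by blast
  next
    case False
    then have k: "k < M" using Suc.prems(1) by simp
    obtain a b where w: "w = a @ b" "a \<in> blocks M" "b \<in> blocks M"
      using Suc.prems(2) by (rule blocks_SucE)
    consider "sublist v a" | "sublist v b" | v1 v2 where "v = v1 @ v2" "suffix v1 a" "prefix v2 b"
      using Suc.prems(3) unfolding w(1) sublist_append by blast
    then show ?thesis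
    proof cases
      case 1
      then show ?thesis using Suc.IH[OF k w(2) _ Suc.prems(4)] by blast
    next
      case 2
      then show ?thesis using Suc.IH[OF k w(3) _ Suc.prems(4)] by blast
    next
      case 3
      obtain p q where p: "p \<in> right_blocks k" "suffix p a" and q: "q \<in> left_blocks k" "prefix q b"
        using first_last_block[OF k w(2)] first_last_block[OF k w(3)] by blast
      have "length p = 4 * 2 ^ k" "length q = 4 * 2 ^ k"
        using p(1) q(1) right_blocks_subset[of k] left_blocks_subset[of k] length_blocks[of _ k]
            by auto
      then have "suffix v1 p" "prefix v2 q"
        using 3 p(2) q(2) Suc.prems(4) suffix_length_suffix[of v1 a p] prefix_length_prefix[of v2
            b q]
        by auto
      then have "sublist v (p @ q)" unfolding sublist_append using 3(1) by blast
      then show ?thesis using p(1) q(1) by blast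
    qed
  qed
qed simp

text \<open>A factor that extends across the border of two blocks has at least half of its length on one
  side of it, and this half contains the last or the first block of level \<open>m\<close> on that side.\<close>

lemma long_sublist_contains_block:
  assumes "m \<le> M" "w \<in> blocks M" "sublist v w" "2 * (4 * 2 ^ m) \<le> length v"
  shows "\<exists>b\<in>blocks m. sublist b v"
  using assms
proof (induction M arbitrary: w rule: nat_induct_at_least)
  case base
  then have "length v \<le> 4 * 2 ^ m" using sublist_length_le[of v w] length_blocks[of w m] by simp
  moreover have "0 < 4 * (2::nat) ^ m" by simp
  ultimately show ?case using base.prems(3) by linarith
next
  case (Suc M)
  obtain a b where w: "w = a @ b" "a \<in> blocks M" "b \<in> blocks M"
    using Suc.prems(1) by (rule blocks_SucE)
  consider "sublist v a" | "sublist v b" | v1 v2 where "v = v1 @ v2" "suffix v1 a" "prefix v2 b"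
    using Suc.prems(2) unfolding w(1) sublist_append by blast
  then show ?case
  proof cases
    case 1
    then show ?thesis using Suc.IH[OF w(2) _ Suc.prems(3)] by blast
  next
    case 2
    then show ?thesis using Suc.IH[OF w(3) _ Suc.prems(3)] by blast
  next
    case 3
    obtain p q where p: "p \<in> blocks m" "suffix p a" and q: "q \<in> blocks m" "prefix q b"
      using first_last_block_le[OF Suc.hyps(1)] w by blast
    have len: "length p = 4 * 2 ^ m" "length q = 4 * 2 ^ m" using p(1) q(1) length_blocks by auto
    show ?thesis
    proof (cases "4 * 2 ^ m \<le> length v1")
      case True
      then have "suffix p v1" using suffix_length_suffix[OF p(2) 3(2)] len by simp
      then show ?thesis using p(1) 3(1) by (auto simp: sublist_append suffix_imp_sublist)
    next
      case False
      then have "4 * 2 ^ m \<le> length v2" using Suc.prems(3) 3(1) by simp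
      then have "prefix q v2" using prefix_length_prefix[OF q(2) 3(3)] len by simp
      then show ?thesis using q(1) 3(1) by (auto simp: sublist_append prefix_imp_sublist)
    qed
  qed
qed

lemma letters_blocks:
  assumes "w \<in> blocks k" "t < length w"
  shows "w ! t mod 4 = t mod 4 \<and> w ! t < 16 * F 0"
  using assms
proof (induction k arbitrary: w t)
  case 0
  then obtain s where s: "w = [4 * s, 1, 2, 3]" "s < 4 * F 0" by auto
  have "t = 0 \<or> t = 1 \<or> t = 2 \<or> t = 3" using 0(2) s(1) by auto
  then show ?case by (elim disjE) (use s F_pos[of 0] in simp_all)
next
  case (Suc k)
  obtain a b where w: "w = a @ b" "a \<in> blocks k" "b \<in> blocks k"
    using Suc.prems(1) by (rule blocks_SucE)
  have len: "length a = 4 * 2 ^ k" using w length_blocks by simp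
  show ?case
  proof (cases "t < length a")
    case True
    then show ?thesis using Suc.IH[OF w(2)] by (simp add: w(1) nth_append)
  next
    case False
    then have "(t - length a) mod 4 = t mod 4" unfolding len
      by (metis le_add_diff_inverse linorder_not_less mod_mult_self2 add.commute mult.commute)
    then show ?thesis using Suc.IH[OF w(3), of "t - length a"] False Suc.prems(2)
      by (simp add: w(1) nth_append)
  qed
qed

section \<open>The limit word\<close>

text \<open>Blocks that extend each other, to the left at even and to the right at odd levels, and the
  positions at which they start when the first of them starts at \<open>0\<close>.\<close>

primrec nest :: "nat \<Rightarrow> nat list"
  where
    "nest 0 = [0, 1, 2, 3]"
  | "nest (Suc k) = (let c = (SOME c. c \<in> selected k) in if even k then c @ nest k else nest k @ c)"

primrec start :: "nat \<Rightarrow> int"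
  where
    "start 0 = 0"
  | "start (Suc k) = (if even k then start k - 4 * 2 ^ k else start k)"

definition stop :: "nat \<Rightarrow> int"
  where "stop k = start k + 4 * 2 ^ k"

lemma nest_in_blocks: "nest k \<in> blocks k"
proof (induction k)
  case 0
  show ?case using F_pos[of 0] by (auto simp: image_iff intro!: bexI[of _ 0])
next
  case (Suc k)
  have "(SOME c. c \<in> selected k) \<in> selected k" using selected_nonempty by (simp add: some_in_eq)
  then show ?case using Suc by (auto simp: blocks_Suc left_blocks_def right_blocks_def Let_def)
qed

lemma length_nest: "length (nest k) = 4 * 2 ^ k"
  using nest_in_blocks length_blocks by blast

lemma start_stop_mono: "k \<le> m \<Longrightarrow> start m \<le> start k \<and> stop k \<le> stop m"
proof (induction m rule: dec_induct)
  case (step m)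
  define q where "q = (2::int) ^ m"
  have "0 < q" by (simp add: q_def)
  moreover have "start (Suc m) = (if even m then start m - 4 * q else start m)"
    "stop (Suc m) = start (Suc m) + 8 * q" "stop m = start m + 4 * q"
    by (simp_all add: q_def stop_def)
  ultimately show ?case using step.IH by auto
qed simp

lemma start_stop_bound: "start (2 * m) \<le> - int m \<and> int m < stop (2 * m)"
proof (induction m)
  case (Suc m)
  have "1 \<le> (2::int) ^ (2 * m)" by simp
  then show ?case using Suc by (simp add: stop_def)
qed (simp add: stop_def)

lemma nest_coherent:
  assumes "k \<le> m" "start k \<le> i" "i < stop k"
  shows "nest m ! nat (i - start m) = nest k ! nat (i - start k)"
  using assms(1)
proof (induction m rule: dec_induct)
  case (step m)
  have i: "start m \<le> i" "i < stop m" using start_stop_mono[OF step.hyps(1)] assms by auto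
  define c where "c = (SOME c. c \<in> selected m)"
  have "c \<in> selected m" unfolding c_def using selected_nonempty by (simp add: some_in_eq)
  then have c: "length c = 4 * 2 ^ m" using selected_subset length_blocks by blast
  show ?case
  proof (cases "even m")
    case True
    have "nat (i - start (Suc m)) = length c + nat (i - start m)"
    proof -
      have "i - start (Suc m) = int (length c) + (i - start m)" using True c by simp
      then show ?thesis using i by (simp add: nat_add_distrib)
    qed
    then show ?thesis using True step.IH by (simp add: c_def[symmetric] Let_def)
  next
    case False
    have "nat (i - start m) < length (nest m)"
      using i by (simp add: length_nest stop_def nat_less_iff)
    then show ?thesis using False step.IH by (simp add: Let_def nth_append)
  qed
qed simp

text \<open>By \<open>start_stop_bound\<close> the level \<open>2 * nat \<bar>i\<bar>\<close> is high enough for the nested block to cover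
  \<open>i\<close>.\<close>

definition x :: "int \<Rightarrow> nat"
  where "x i = nest (2 * nat \<bar>i\<bar>) ! nat (i - start (2 * nat \<bar>i\<bar>))"

lemma x_eq:
  assumes "start k \<le> i" "i < stop k"
  shows "x i = nest k ! nat (i - start k)"
proof -
  let ?m = "2 * nat \<bar>i\<bar>"
  let ?M = "max k ?m"
  have m: "start ?m \<le> i" "i < stop ?m" using start_stop_bound[of "nat \<bar>i\<bar>"] by auto
  have "x i = nest ?M ! nat (i - start ?M)"
    unfolding x_def by (rule nest_coherent[OF _ m, symmetric]) simp
  also have "\<dots> = nest k ! nat (i - start k)" by (rule nest_coherent[OF _ assms]) simp
  finally show ?thesis .
qed

lemma window_nest: "window x (start k) (4 * 2 ^ k) = nest k"
proof (rule nth_equalityI)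
  fix t assume "t < length (window x (start k) (4 * 2 ^ k))"
  then have t: "t < 4 * 2 ^ k" by simp
  then have "int t < int (4 * 2 ^ k)" by (simp only: of_nat_less_iff)
  then have "int t < 4 * 2 ^ k" by simp
  then show "window x (start k) (4 * 2 ^ k) ! t = nest k ! t"
    using x_eq[of k "start k + int t"] t by (simp add: window_def stop_def)
qed (simp add: length_nest)

lemma window_shift: "d + n \<le> N \<Longrightarrow> window x (i + int d) n = take n (drop d (window x i N))"
  by (rule nth_equalityI) (auto simp: window_def add.assoc)

lemma sublist_window:
  assumes "d + n \<le> N"
  shows "sublist (window x (i + int d) n) (window x i N)"
  unfolding window_shift[OF assms] by (meson sublist_drop sublist_order.order.trans sublist_take)

lemma sublist_window_occurs:
  assumes "sublist z (window x i N)"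
  shows "\<exists>d\<le>N. window x (i + int d) (length z) = z"
proof -
  obtain p s where ps: "window x i N = p @ z @ s" using assms by (auto simp: sublist_def)
  from arg_cong[OF this, of length] have "length p + length z \<le> N" by simp
  then have "window x (i + int (length p)) (length z) = z" "length p \<le> N"
    using ps window_shift[of "length p" "length z" N i] by simp_all
  then show ?thesis by blast
qed

lemma window_in_nest:
  "\<exists>M\<ge>k. start M \<le> i \<and> i + int n \<le> stop M \<and> sublist (window x i n) (nest M)"
proof -
  define r where "r = k + nat \<bar>i\<bar> + n"
  have M: "start (2 * r) \<le> i" "i + int n \<le> stop (2 * r)" "k \<le> 2 * r"
    using start_stop_bound[of r] by (auto simp: r_def)
  define d where "d = nat (i - start (2 * r))"
  have d: "i = start (2 * r) + int d" using M by (simp add: d_def)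
  have "int d + int n \<le> 4 * 2 ^ (2 * r)" using M d by (simp add: stop_def)
  then have "int (d + n) \<le> int (4 * 2 ^ (2 * r))" by simp
  then have "d + n \<le> 4 * 2 ^ (2 * r)" by (simp only: of_nat_le_iff)
  then have "sublist (window x i n) (window x (start (2 * r)) (4 * 2 ^ (2 * r)))"
    unfolding d by (rule sublist_window)
  then show ?thesis using M by (intro exI[of _ "2 * r"]) (simp add: window_nest)
qed

text \<open>All blocks of some level \<open>m\<close> contain \<open>z\<close>, and each window of twice their length contains one
  of them.\<close>

lemma block_syndetic:
  assumes "z \<in> blocks j"
  shows "\<exists>N. \<forall>i. \<exists>d<N. window x (i + int d) (4 * 2 ^ j) = z"
proof -
  obtain m where m: "\<And>w. w \<in> blocks m \<Longrightarrow> sublist z w" using eventually_contained[OF assms] by blast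
  let ?L = "2 * (4 * 2 ^ m) :: nat"
  have "\<exists>d<Suc ?L. window x (i + int d) (4 * 2 ^ j) = z" for i
  proof -
    obtain M where M: "m \<le> M" "sublist (window x i ?L) (nest M)" using window_in_nest by blast
    obtain b where b: "b \<in> blocks m" "sublist b (window x i ?L)"
      using long_sublist_contains_block[OF M(1) nest_in_blocks M(2)] by auto
    have "sublist z (window x i ?L)" using m[OF b(1)] b(2) sublist_order.order.trans by blast
    then show ?thesis using sublist_window_occurs length_blocks[OF assms] by (metis less_Suc_eq_le)
  qed
  then show ?thesis by blast
qed

lemma blocks_subset_factors: "blocks k \<subseteq> factors x (4 * 2 ^ k)"
  using block_syndetic unfolding factors_def by (metis rangeI subsetI)

text \<open>A word of period \<open>p\<close> has at most \<open>p\<close> factors of each length, whereas the number of blocks is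
  unbounded.\<close>

lemma x_aperiodic:
  assumes "l \<noteq> 0"
  shows "\<exists>i. x (i + l) \<noteq> x i"
proof (rule ccontr)
  assume "\<not> ?thesis"
  then have per0: "x (i + l) = x i" for i by auto
  define p where "p = \<bar>l\<bar>"
  have p: "0 < p" using assms by (simp add: p_def)
  have per: "x (i + p) = x i" for i
    using per0[of i] per0[of "i - l"] by (cases "0 \<le> l") (auto simp: p_def)
  have per_mult: "x (i + p * int t) = x i" for i t
  proof (induction t)
    case (Suc t)
    then show ?case using per[of "i + p * int t"] by (simp add: algebra_simps)
  qed simp
  have per_mod: "x (i + m) = x (i mod p + m)" for i m
  proof (cases "0 \<le> i div p")
    case True
    have "i + m = (i mod p + m) + p * int (nat (i div p))"
      using True mult_div_mod_eq[of p i] by simp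
    then show ?thesis by (metis per_mult)
  next
    case False
    have "i = i mod p + p * (i div p)" by simp
    then have "i mod p + m = (i + m) + p * int (nat (- (i div p)))"
      using False by (simp add: algebra_simps)
    then show ?thesis by (metis per_mult)
  qed
  have "factors x n \<subseteq> (\<lambda>i. window x i n) ` {0..<p}" for n
  proof
    fix u assume "u \<in> factors x n"
    then obtain i where "u = window x i n" by (auto simp: factors_def)
    moreover have "window x i n = window x (i mod p) n" unfolding window_eq_iff using per_mod
        by blast
    ultimately have "u = window x (i mod p) n" by simp
    then show "u \<in> (\<lambda>i. window x i n) ` {0..<p}" using p by auto
  qed
  then have "blocks (nat p) \<subseteq> (\<lambda>i. window x i (4 * 2 ^ nat p)) ` {0..<p}"
    using blocks_subset_factors by blast
  then have "card (blocks (nat p)) \<le> card {0..<p}"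
    by (metis card_image_le card_mono finite_atLeastLessThan_int finite_imageI le_trans)
  also have "\<dots> = nat p" by simp
  also have "\<dots> < 2 ^ nat p" by (rule less_exp)
  also have "\<dots> \<le> 2 ^ (nat p + 2)" by (rule power_increasing) auto
  also have "\<dots> \<le> F (nat p) * 2 ^ (nat p + 2)" using F_pos[of "nat p"] by simp
  also have "\<dots> \<le> card (blocks (nat p))" using card_blocks_bounds by blast
  finally show False by simp
qed

lemma start_mod4: "start k mod 4 = 0"
  by (induction k) (simp_all add: mod_diff_eq mod_simps, presburger)

lemma x_letter: "int (x i) mod 4 = i mod 4 \<and> x i < 16 * F 0"
proof -
  obtain M where M: "start M \<le> i" "i < stop M" using window_in_nest[of 0 i 1] by auto
  then have t: "nat (i - start M) < length (nest M)"
      by (simp add: length_nest stop_def nat_less_iff)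
  have "int (nat (i - start M)) mod 4 = i mod 4"
    using M(1) start_mod4[of M] by (simp add: mod_diff_right_eq[symmetric])
  then show ?thesis using letters_blocks[OF nest_in_blocks t] x_eq[OF M]
      by (metis of_nat_numeral zmod_int)
qed

text \<open>Every factor of \<open>x\<close> lies in some \<open>nest M\<close>, which is a block and as such recurs with bounded
  gaps. The square of a selected block is a block of the next level, so the first half of it
  repeats at a distance that is a power of two.\<close>

sublocale recurrent_word x "16 * F 0"
proof
  show "x i < 16 * F 0" "int (x i) mod 4 = i mod 4" for i using x_letter by auto
  show "\<exists>i. x (i + l) \<noteq> x i" if "l \<noteq> 0" for l by (rule x_aperiodic[OF that])
  show "\<exists>i k. agree x n i (i + 2 ^ k)" for n
  proof -
    \<comment> \<open>Level \<open>n\<close> makes the block \<open>c\<close> longer than a window of radius \<open>n\<close>.\<close>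
    obtain c where c: "c \<in> selected n" using selected_nonempty by blast
    then have len: "length c = 4 * 2 ^ n" using selected_subset length_blocks by blast
    have "c @ c \<in> blocks (Suc n)" using c selected_subset[of n]
        by (auto simp: blocks_Suc left_blocks_def right_blocks_def)
    then obtain p where p: "window x p (4 * 2 ^ Suc n) = c @ c"
      using blocks_subset_factors[of "Suc n"] by (auto simp: factors_def)
    have "window x p (4 * 2 ^ n) = c" "window x (p + int (4 * 2 ^ n)) (4 * 2 ^ n) = c"
      using window_shift[of 0 "4 * 2 ^ n" "4 * 2 ^ Suc n" p]
        window_shift[of "4 * 2 ^ n" "4 * 2 ^ n" "4 * 2 ^ Suc n" p] p len by simp_all
    then have eq: "x (p + int t) = x (p + int (4 * 2 ^ n) + int t)" if "t < 4 * 2 ^ n" for t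
      using that window_eq_iff[of x p "4 * 2 ^ n" "p + int (4 * 2 ^ n)"] by metis
    have "agree x n (p + int n) (p + int n + 2 ^ (n + 2))"
      unfolding agree_def
    proof (intro allI impI)
      fix m assume m: "\<bar>m\<bar> \<le> int n"
      have "2 * n < 4 * 2 ^ n" using less_exp[of n] by linarith
      then have "nat (int n + m) < 4 * 2 ^ n" using m by linarith
      moreover have "0 \<le> int n + m" using m by linarith
      ultimately show "x (p + int n + m) = x (p + int n + 2 ^ (n + 2) + m)"
        using eq[of "nat (int n + m)"] by (simp add: power_add algebra_simps)
    qed
    then show ?thesis by blast
  qed
  show "\<exists>N. \<forall>j. \<exists>d<N. agree x n i (j + int d)" for n i
  proof -
    obtain M where M: "start M \<le> i - int n" "i - int n + int (2 * n + 1) \<le> stop M"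
      using window_in_nest[of 0 "i - int n" "2 * n + 1"] by blast
    obtain N where N: "\<And>j. \<exists>d<N. window x (j + int d) (4 * 2 ^ M) = nest M"
      using block_syndetic[OF nest_in_blocks] by blast
    define s where "s = nat (i - start M)"
    have s: "i = start M + int s" using M by (simp add: s_def)
    have "\<exists>d<N + s. agree x n i (j + int d)" for j
    proof -
      obtain d where d: "d < N" "window x (j + int d) (4 * 2 ^ M) = window x (start M) (4 * 2 ^ M)"
        using N window_nest by metis
      then have eq: "x (j + int d + int t) = x (start M + int t)" if "t < 4 * 2 ^ M" for t
        using that unfolding window_eq_iff by blast
      have "agree x n i (j + int (d + s))"
        unfolding agree_def
      proof (intro allI impI)
        fix m assume m: "\<bar>m\<bar> \<le> int n"
        then have "0 \<le> int s + m" "int s + m < 4 * 2 ^ M" using M s by (simp_all add: stop_def)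
        moreover from this have "nat (int s + m) < 4 * 2 ^ M"
          by (simp add: nat_less_iff)
        ultimately show "x (i + m) = x (j + int (d + s) + m)"
          using eq[of "nat (int s + m)"] by (simp add: s algebra_simps)
      qed
      then show ?thesis using d(1) by (intro exI[of _ "d + s"]) simp
    qed
    then show ?thesis by blast
  qed
qed

lemma complexity_lower: "F k \<le> complexity x (4 * 2 ^ k)"
proof -
  have "F k \<le> F k * 2 ^ (k + 2)" by simp
  also have "\<dots> \<le> card (blocks k)" using card_blocks_bounds by blast
  also have "\<dots> \<le> complexity x (4 * 2 ^ k)"
    unfolding complexity_def by (rule card_mono[OF finite_factors blocks_subset_factors])
  finally show ?thesis .
qed

text \<open>A factor is determined by the pair of adjacent blocks that it meets and by its offset in
  it.\<close>

lemma complexity_upper: "complexity x (4 * 2 ^ k) \<le> 2 ^ (2 * k + 8) * F (Suc k)"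
proof -
  let ?l = "4 * 2 ^ k :: nat"
  let ?D = "(\<lambda>(a, b). a @ b) ` (left_blocks k \<times> right_blocks k \<union> right_blocks k \<times> left_blocks k)"
  have len: "length d = 2 * ?l" if "d \<in> ?D" for d
  proof -
    obtain a b where "d = a @ b" "a \<in> blocks k" "b \<in> blocks k"
      using \<open>d \<in> ?D\<close> left_blocks_subset[of k] right_blocks_subset[of k] by auto
    then show ?thesis using length_blocks[of a k] length_blocks[of b k] by simp
  qed
  have "factors x ?l \<subseteq> (\<lambda>(p, d). take ?l (drop p d)) ` ({..?l} \<times> ?D)"
  proof
    fix v assume "v \<in> factors x ?l"
    then obtain i where v: "v = window x i ?l" by (auto simp: factors_def)
    obtain M where M: "Suc k \<le> M" "sublist v (nest M)" using window_in_nest unfolding v by blast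
    have lv: "length v = ?l" by (simp add: v)
    obtain d where d: "d \<in> ?D" "sublist v d"
      using short_sublist_in_pair[OF _ nest_in_blocks M(2), of k] M(1) lv by auto
    obtain p s where ps: "d = p @ v @ s" using d(2) by (auto simp: sublist_def)
    then have "v = take ?l (drop (length p) d)" "length p \<le> ?l" using lv len[OF d(1)] by auto
    then show "v \<in> (\<lambda>(p, d). take ?l (drop p d)) ` ({..?l} \<times> ?D)"
      using d(1) by (intro image_eqI[of _ _ "(length p, d)"]) auto
  qed
  moreover have finD: "finite ?D"
    using finite_blocks[of k] left_blocks_subset[of k] right_blocks_subset[of k]
        by (meson finite_SigmaI finite_UnI
      finite_imageI finite_subset)
  ultimately have "complexity x ?l \<le> card ((\<lambda>(p, d). take ?l (drop p d)) ` ({..?l} \<times> ?D))"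
    unfolding complexity_def by (intro card_mono finite_imageI) auto
  also have "\<dots> \<le> card ({..?l} \<times> ?D)" using finD by (intro card_image_le) auto
  also have "\<dots> = (?l + 1) * card ?D" by (simp add: card_cartesian_product)
  also have "\<dots> \<le> (?l + 1) * (card (blocks (Suc k)) + card (blocks (Suc k)))"
  proof (rule mult_le_mono2)
    have "card ?D \<le> card ((\<lambda>(a, b). a @ b) ` (left_blocks k \<times> right_blocks k))
        + card ((\<lambda>(a, b). a @ b) ` (right_blocks k \<times> left_blocks k))"
      unfolding image_Un by (rule card_Un_le)
    also have "\<dots> = card (blocks (Suc k)) + card (blocks (Suc k))"
      unfolding card_append_blocks[OF left_blocks_subset right_blocks_subset]
          card_append_blocks[OF right_blocks_subset left_blocks_subset]
        card_blocks_Suc by (simp add: left_blocks_def right_blocks_def)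
    finally show "card ?D \<le> card (blocks (Suc k)) + card (blocks (Suc k))" .
  qed
  also have "\<dots> \<le> (2 * ?l) * (2 * (F (Suc k) * 2 ^ (k + 4)))"
  proof (intro mult_mono)
    have "Suc k + 3 = k + 4" by simp
    then show "card (blocks (Suc k)) + card (blocks (Suc k)) \<le> 2 * (F (Suc k) * 2 ^ (k + 4))"
      using card_blocks_bounds[of "Suc k"] by (simp only: mult_2 add_mono)
  qed auto
  also have "\<dots> = 2 ^ (2 * k + 8) * F (Suc k)"
  proof -
    have "2 ^ (2 * k + 8) = 2 ^ k * 2 ^ k * (256::nat)" by (simp only: power_add mult_2) simp
    then show ?thesis by (simp add: power_add)
  qed
  finally show ?thesis .
qed

end

section \<open>Comparison of growth rates\<close>

lemma growth_le_trans:
  assumes "f \<preceq>\<^sub>g g" "g \<preceq>\<^sub>g h"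
  shows "f \<preceq>\<^sub>g h"
proof -
  obtain C D where f: "C > 0" "D > 0" "\<And>n. n \<ge> 1 \<Longrightarrow> f n \<le> C * g (D * n)"
    using assms(1) by (auto simp: growth_le_def)
  obtain C' D' where g: "C' > 0" "D' > 0" "\<And>n. n \<ge> 1 \<Longrightarrow> g n \<le> C' * h (D' * n)"
    using assms(2) by (auto simp: growth_le_def)
  have "f n \<le> (C * C') * h ((D' * D) * n)" if "n \<ge> 1" for n
  proof -
    have "1 \<le> D * n" using f(2) that by (simp add: Suc_le_eq)
    then have "C * g (D * n) \<le> C * (C' * h (D' * (D * n)))"
      using g(3) f(1) by (intro mult_left_mono) auto
    then show ?thesis using f(3)[OF that] by (simp add: mult.assoc)
  qed
  then show ?thesis
    unfolding growth_le_def using f(1,2) g(1,2)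
    by (intro exI[of _ "C * C'"] conjI exI[of _ "D' * D"]) auto
qed

lemma growth_equiv_trans: "f \<sim>\<^sub>g g \<Longrightarrow> g \<sim>\<^sub>g h \<Longrightarrow> f \<sim>\<^sub>g h"
  unfolding growth_equiv_def using growth_le_trans by blast

lemma absorb_powers:
  fixes f :: "nat \<Rightarrow> real"
  assumes "(\<lambda>n. real n * f n) \<preceq>\<^sub>g f"
  shows "(\<lambda>n. real n ^ s * f n) \<preceq>\<^sub>g f"
proof (induction s)
  case 0
  show ?case unfolding growth_le_def by (intro exI[of _ 1] conjI) auto
next
  case (Suc s)
  have "(\<lambda>n. real n ^ Suc s * f n) \<preceq>\<^sub>g (\<lambda>n. real n * f n)"
  proof -
    obtain C D where CD: "C > 0" "D > 0" "\<And>n. n \<ge> 1 \<Longrightarrow> real n ^ s * f n \<le> C * f (D * n)"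
      using Suc by (auto simp: growth_le_def)
    have "real n ^ Suc s * f n \<le> (C / real D) * (real (D * n) * f (D * n))" if "n \<ge> 1" for n
    proof -
      have "real n * (real n ^ s * f n) \<le> real n * (C * f (D * n))"
        using CD(3)[OF that] by (rule mult_left_mono) simp
      then show ?thesis using CD(2) by (simp add: mult_ac)
    qed
    then show ?thesis unfolding growth_le_def using CD(1,2)
      by (intro exI[of _ "C / real D"] conjI exI[of _ D]) auto
  qed
  then show ?case using assms by (rule growth_le_trans)
qed

lemma power_of_two_between:
  assumes "1 \<le> m"
  shows "\<exists>k. m \<le> 2 ^ k \<and> 2 ^ k < 2 * (m::nat)"
proof -
  define k where "k = (LEAST k. m \<le> 2 ^ k)"
  have ex: "m \<le> 2 ^ m" by (rule less_imp_le[OF less_exp])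
  then have k: "m \<le> 2 ^ k" unfolding k_def by (rule LeastI)
  have "2 ^ k < 2 * m"
  proof (cases k)
    case 0
    then show ?thesis using assms by simp
  next
    case (Suc j)
    then have "\<not> m \<le> 2 ^ j" unfolding k_def using not_less_Least[of j "\<lambda>k. m \<le> 2 ^ k"] by simp
    then show ?thesis using Suc by simp
  qed
  with k show ?thesis by blast
qed

lemma (in recurrent_word) complexity_mono:
  assumes "m \<le> n"
  shows "complexity x m \<le> complexity x n"
proof -
  have "factors x m \<subseteq> take m ` factors x n"
    using assms by (auto simp: factors_def window_def take_map image_iff intro!: exI)
  then have "complexity x m \<le> card (take m ` factors x n)"
    unfolding complexity_def by (intro card_mono finite_imageI finite_factors)
  also have "\<dots> \<le> complexity x n"
    unfolding complexity_def by (rule card_image_le[OF finite_factors])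
  finally show ?thesis .
qed

theorem theorem1p1:
  fixes f :: "nat \<Rightarrow> nat"
  assumes char: "CHAR('a::field) \<noteq> 2"
    and pos: "\<And>n. n \<ge> 1 \<Longrightarrow> f n \<ge> 1"
    and increasing: "\<And>n. n \<ge> 1 \<Longrightarrow> f n < f (n + 1)"
    and submult: "\<And>n m. n \<ge> 1 \<Longrightarrow> m \<ge> 1 \<Longrightarrow> f (n + m) \<le> f n * f m"
    and equiv: "(\<lambda>n. real (f n)) \<sim>\<^sub>g (\<lambda>n. real n * real (f n))"
  shows "\<exists>br :: 'a poly \<Rightarrow> 'a poly \<Rightarrow> 'a poly.
           lie_algebra smult br \<and>
           lie_algebra.finitely_generated smult br \<and>
           lie_algebra.simple smult br \<and>
           (\<forall>V. lie_algebra.fin_dim_subspace smult V \<and> lie_algebra.generates smult br V \<longrightarrow>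
                (\<lambda>n. real (lie_algebra.growth smult br V n)) \<sim>\<^sub>g (\<lambda>n. real (f n)))"
proof -
  have two: "(2::'a) \<noteq> 0"
  proof
    assume "(2::'a) = 0"
    then have "of_nat 2 = (0::'a)" by simp
    then have "CHAR('a) dvd 2" by (simp only: of_nat_eq_0_iff_char_dvd)
    then have "CHAR('a) = 1 \<or> CHAR('a) = 2" using two_is_prime_nat prime_nat_iff by blast
    then show False using char by simp
  qed
  have mono: "f m \<le> f n" if "1 \<le> m" "m \<le> n" for m n
    using that(2)
  proof (induction n rule: dec_induct)
    case (step n)
    then show ?case using increasing[of n] that(1) by simp
  qed simp
  have ge: "n \<le> f n" if "1 \<le> n" for n
    using that
  proof (induction n rule: dec_induct)
    case base
    show ?case using pos[of 1] by simp
  next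
    case (step n)
    then show ?case using increasing[of n] by simp
  qed
  define F where "F k = f (2 ^ k)" for k
  interpret block_words F
  proof
    fix k
    show "1 \<le> F k" unfolding F_def by (rule pos) simp
    show "F k \<le> F (Suc k)" unfolding F_def by (rule mono) auto
    show "F (Suc k) \<le> F k * F k" unfolding F_def using submult[of "2 ^ k" "2 ^ k"]
        by (simp add: mult_2)
  qed
  have "\<exists>m\<ge>1. n < complexity x m" for n
  proof (intro exI conjI)
    have "n < 2 ^ n" by (rule less_exp)
    also have "\<dots> \<le> F n" unfolding F_def by (rule ge) simp
    also have "\<dots> \<le> complexity x (4 * 2 ^ n)" by (rule complexity_lower)
    finally show "n < complexity x (4 * 2 ^ n)" .
  qed simp
  from word_lie_algebra[OF two this]
  obtain br :: "'a poly \<Rightarrow> 'a poly \<Rightarrow> 'a poly" and h where br: "lie_algebra smult br"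
      "lie_algebra.finitely_generated smult br" "lie_algebra.simple smult br"
    and h: "\<And>n. n \<ge> 1 \<Longrightarrow> complexity x n \<le> h (2 * n)"
      "\<And>n. h n \<le> (14 * n + 1) * complexity x (14 * n + 1)" "mono h"
    and V: "\<And>V. lie_algebra.fin_dim_subspace smult V \<Longrightarrow> lie_algebra.generates smult br V \<Longrightarrow>
        (\<lambda>n. real (lie_algebra.growth smult br V n)) \<sim>\<^sub>g (\<lambda>n. real (h n))"
    by blast
  have lower: "(\<lambda>n. real (f n)) \<preceq>\<^sub>g (\<lambda>n. real (h n))"
  proof -
    have "real (f n) \<le> 1 * real (h (16 * n))" if n: "n \<ge> 1" for n
    proof -
      obtain k where k: "n \<le> 2 ^ k" "2 ^ k < 2 * n" using power_of_two_between[OF n] by blast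
      have "f n \<le> F k" unfolding F_def using n k(1) by (rule mono)
      also have "\<dots> \<le> complexity x (4 * 2 ^ k)" by (rule complexity_lower)
      also have "\<dots> \<le> h (2 * (4 * 2 ^ k))" by (rule h(1)) simp
      also have "\<dots> \<le> h (16 * n)" by (rule monoD[OF h(3)]) (use k(2) in simp)
      finally show ?thesis by simp
    qed
    then show ?thesis unfolding growth_le_def by (intro exI[of _ 1] conjI exI[of _ 16]) auto
  qed
  have upper: "(\<lambda>n. real (h n)) \<preceq>\<^sub>g (\<lambda>n. real n ^ 3 * real (f n))"
  proof -
    \<comment> \<open>With \<open>4 * n \<le> 2 ^ k < 8 * n\<close> the length \<open>14 * n + 1\<close> is at most \<open>4 * 2 ^ k\<close>, and
      \<open>15 * 256 * 8\<^sup>2 = 60 * 16\<^sup>3\<close>.\<close>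
    have "real (h n) \<le> 60 * (real (16 * n) ^ 3 * real (f (16 * n)))" if n: "n \<ge> 1" for n
    proof -
      obtain k where k: "4 * n \<le> 2 ^ k" "2 ^ k < 8 * n"
        using power_of_two_between[of "4 * n"] n by auto
      have "complexity x (14 * n + 1) \<le> complexity x (4 * 2 ^ k)"
        by (rule complexity_mono) (use k(1) n in simp)
      also have "\<dots> \<le> 2 ^ (2 * k + 8) * F (Suc k)" by (rule complexity_upper)
      also have "2 ^ (2 * k + 8) = 256 * ((2 ^ k) * (2 ^ k) :: nat)"
        by (simp only: power_add mult_2) simp
      also have "256 * (2 ^ k * 2 ^ k) * F (Suc k) \<le> 256 * ((8 * n) * (8 * n)) * f (16 * n)"
        unfolding F_def using k(2) by (intro mult_mono mono) auto
      finally have c: "complexity x (14 * n + 1) \<le> 256 * ((8 * n) * (8 * n)) * f (16 * n)" .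
      have "h n \<le> (14 * n + 1) * complexity x (14 * n + 1)" by (rule h(2))
      also have "\<dots> \<le> (15 * n) * (256 * ((8 * n) * (8 * n)) * f (16 * n))"
        using c n by (intro mult_mono) auto
      also have "\<dots> = 60 * ((16 * n) ^ 3 * f (16 * n))" by (simp add: power3_eq_cube)
      finally show ?thesis by (metis of_nat_le_iff of_nat_mult of_nat_numeral of_nat_power)
    qed
    then show ?thesis unfolding growth_le_def by (intro exI[of _ 60] conjI exI[of _ 16]) auto
  qed
  have "(\<lambda>n. real n ^ 3 * real (f n)) \<preceq>\<^sub>g (\<lambda>n. real (f n))"
    by (rule absorb_powers) (use equiv in \<open>simp add: growth_equiv_def\<close>)
  with lower upper have "(\<lambda>n. real (h n)) \<sim>\<^sub>g (\<lambda>n. real (f n))"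
    unfolding growth_equiv_def using growth_le_trans by blast
  then show ?thesis using br V growth_equiv_trans by blast
qed

end
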